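(* Assume that $X$ is a Banach space with a normalized Schauder basis which is $C$-strategically reproducible (for some $C\ge 1$) and has the $K$-diagonal factorization property for some $K\colon(0,\infty)\to(0,\infty)$. For $k,j\in\mathbb{N}$ let $e_{(k,j)}$ be the $j$-th basis element of the $k$-th component in $Z=\ell^\infty(X)$, and let $e_{(k,j)}^*$ be the corresponding coordinate functional. Then the array $(e_{(k,j)})_{k,j}$ is simultaneously $C$-strategically reproducible in $Z=\ell^\infty(X)$, and the identity on $Z$ factors through every bounded linear operator $T\colon Z\to Z$ with large diagonal, i.e. for every bounded linear $T\colon Z\to Z$ with $\inf_{k,j}|e^*_{(k,j)}(Te_{(k,j)})|>0$ there are bounded linear operators $A,B\colon Z\to Z$ with $I_Z=ATB$.
   Context: Spaces. $\ell^\infty(X)$ is the space of bounded sequences $(x_k)_{k\in\mathbb{N}}$ in $X$ with norm $\sup_k\|x_k\|_X$. Its $k$-th component $X_k=X$ is identified with the subspace of sequences supported at $k$; $e^*_{(k,j)}$ acts on $Z$ by applying the $j$-th coordinate functional of the basis to the $k$-th coordinate. Diagonal factorization. Let $X$ have a normalized Schauder basis $(e_j)$ with coordinate functionals $(e_j^* )$. A bounded operator $T\colon X\to X$ is diagonal if $e_m^*(Te_j)=0$ whenever $m\ne j$. For $c>0$, the identity $c$-factors through $T$ if there are bounded linear $A,B\colon X\to X$ with $\|A\|\|B\|\le c$ and $I=ATB$; it almost $c$-factors if it $(c+\varepsilon)$-factors for every $\varepsilon>0$. The basis has the $K$-diagonal factorization property in $X$ if for every $\delta>0$ and every bounded diagonal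 operator $T\colon X\to X$ with $\inf_j|e^*_j(Te_j)|\ge\delta$ the identity on $X$ almost $K(\delta)$-factors through $T$. Impartial equivalence. Sequences $(x_i)$, $(\tilde x_i)$ in Banach spaces are impartially $C$-equivalent if $\frac1{\sqrt C}\|\sum a_i\tilde x_i\|\le\|\sum a_ix_i\|\le\sqrt C\|\sum a_i\tilde x_i\|$ for all finitely supported scalar sequences $(a_i)$. Strategic reproducibility. Let $\mathrm{cof}(X)$ be the set of cofinite dimensional subspaces of $X$ and $\mathrm{cof}_{w^*}(X^* )$ the set of cofinite dimensional $w^*$-closed subspaces of $X^*$. For $C\ge1$, $\eta>0$ consider the following game between Players I and II, for $X$ with normalized Schauder basis $(e_j)$. Pregame: Player I chooses a partition $\mathbb{N}=N_1\cup N_2$. Turn $n$ ($n=1,2,\dots$): Step 1: Player I chooses $\eta_n>0$, $W_n\in\mathrm{cof}(X)$, $G_n\in\mathrm{cof}_{w^*}(X^* )$. Step 2: Player II chooses $i_n\in\{1,2\}$, a finite set $E_n\subset N_{i_n}$, and non-negative reals $(\lambda_i^{(n)})_{i\in E_n}$, $(\mu_i^{(n)})_{i\in E_n}$ with $1-\eta<\sum_{i\in E_n}\lambda_i^{(n)}\mu_i^{(n)}<1+\eta$. Step 3: Player I chooses signs $(\varepsilon_i^{(n)})_{i\in E_n}\in\{-1,1\}^{E_n}$. Put $x_j=\sum_{i\in E_j}\varepsilon_i^{(j)}\lambda_i^{(j)}e_i$ and $x_j^*=\sum_{i\in E_j}\varepsilon_i^{(j)}\mu_i^{(j)}e_i^*$.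 Player II has a winning strategy if he can force: (1) $(x_j)$ and $(e_j)$ are impartially $(C+\eta)$-equivalent; (2) $(x_j^* )$ and $(e_j^* )$ are impartially $(C+\eta)$-equivalent; (3) $\mathrm{dist}(x_j,W_j)<\eta_j$ for all $j$; (4) $\mathrm{dist}(x_j^*,G_j)<\eta_j$ for all $j$. The basis $(e_j)$ is $C$-strategically reproducible in $X$ if for every $\eta>0$ Player II has a winning strategy in this game. Simultaneous version. The array $(e_{(k,j)})_{k,j}$ is simultaneously $C$-strategically reproducible in $Z$ if for every $k\in\mathbb{N}$ the basis $(e_{(k,j)})_j$ is $C$-strategically reproducible in the $k$-th component $X_k$. *)

theory Defs
  imports "HOL-Analysis.Analysis"
begin

text \<open>
  All spaces are real. Notions that are needed both for \<open>X\<close> and for the components of \<open>\<ell>\<^sup>\<infinity>(X)\<close> are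
  stated for a complete linear subspace \<open>S\<close> of a normed space; a whole space is \<open>S = UNIV\<close>. Sequences are indexed by \<open>nat\<close>, starting at \<open>0\<close>.
\<close>


section \<open>The dual of a subspace\<close>

text \<open>
  A functional on \<open>S\<close> is represented by its extension by \<open>0\<close> to the ambient type. For such an
  \<open>f\<close> the number \<open>onorm f\<close> is the norm of \<open>f\<close> as an element of the dual of \<open>S\<close>.
\<close>

definition dual_on :: "'a::real_normed_vector set \<Rightarrow> ('a \<Rightarrow> real) set" where
  "dual_on S = {f.
     (\<forall>x\<in>S. \<forall>y\<in>S. f (x + y) = f x + f y) \<and>
     (\<forall>c. \<forall>x\<in>S. f (c *\<^sub>R x) = c * f x) \<and>
     (\<exists>B. \<forall>x\<in>S. \<bar>f x\<bar> \<le> B * norm x) \<and>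
     (\<forall>x. x \<notin> S \<longrightarrow> f x = 0)}"

lemma dual_on_UNIV: "dual_on UNIV = {f. bounded_linear f}"
proof (intro set_eqI iffI)
  fix f :: "'a \<Rightarrow> real"
  assume "f \<in> dual_on UNIV"
  then obtain B where "\<And>x y. f (x + y) = f x + f y" "\<And>c x. f (c *\<^sub>R x) = c * f x"
    "\<And>x. \<bar>f x\<bar> \<le> B * norm x"
    unfolding dual_on_def by auto
  then show "f \<in> {f. bounded_linear f}"
    by (auto intro!: bounded_linear_intro[where K = B] simp: mult.commute)
next
  fix f :: "'a \<Rightarrow> real"
  assume "f \<in> {f. bounded_linear f}"
  then have f: "bounded_linear f" by simp
  then obtain B where "\<And>x. norm (f x) \<le> norm x * B"
    using bounded_linear.bounded by blast
  then have "\<exists>B. \<forall>x. \<bar>f x\<bar> \<le> B * norm x"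
    by (auto intro!: exI[of _ B] simp: mult.commute)
  then show "f \<in> dual_on UNIV"
    using f by (simp add: dual_on_def linear_simps)
qed

definition dual_infdist :: "('a::real_normed_vector \<Rightarrow> real) \<Rightarrow> ('a \<Rightarrow> real) set \<Rightarrow> real" where
  "dual_infdist f G = (INF g\<in>G. onorm (\<lambda>x. f x - g x))"

definition cof :: "'a::real_normed_vector set \<Rightarrow> 'a set set" where
  "cof S = {W. W \<subseteq> S \<and> subspace W \<and> (\<exists>F. finite F \<and> F \<subseteq> S \<and> S \<subseteq> span (W \<union> F))}"

text \<open>
  The type \<open>'a \<Rightarrow> real\<close> carries the topology of pointwise convergence, so its subspace topology
  on \<open>dual_on S\<close> is the weak-* topology of the dual of \<open>S\<close>.
\<close>

definition cof_wstar :: "'a::real_normed_vector set \<Rightarrow> ('a \<Rightarrow> real) set set" where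
  "cof_wstar S = {G. G \<subseteq> dual_on S \<and>
     (\<lambda>x. 0) \<in> G \<and>
     (\<forall>f\<in>G. \<forall>g\<in>G. (\<lambda>x. f x + g x) \<in> G) \<and>
     (\<forall>c. \<forall>f\<in>G. (\<lambda>x. c * f x) \<in> G) \<and>
     (\<exists>F. finite F \<and> F \<subseteq> dual_on S \<and>
        (\<forall>f\<in>dual_on S. \<exists>g\<in>G. \<exists>c. f = (\<lambda>x. g x + (\<Sum>h\<in>F. c h * h x)))) \<and>
     closedin (top_of_set (dual_on S)) G}"


section \<open>Schauder bases, diagonal factorization, impartial equivalence\<close>

definition normalized_schauder_basis :: "'a::real_normed_vector set \<Rightarrow> (nat \<Rightarrow> 'a) \<Rightarrow> bool" where
  "normalized_schauder_basis S e \<longleftrightarrow>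
     (\<forall>j. e j \<in> S \<and> norm (e j) = 1) \<and>
     (\<forall>x\<in>S. \<exists>!a :: nat \<Rightarrow> real. (\<lambda>j. a j *\<^sub>R e j) sums x)"

definition coord :: "'a::real_normed_vector set \<Rightarrow> (nat \<Rightarrow> 'a) \<Rightarrow> nat \<Rightarrow> 'a \<Rightarrow> real" where
  "coord S e j x = (if x \<in> S then (THE a. (\<lambda>i. a i *\<^sub>R e i) sums x) j else 0)"

definition diagonal_operator :: "(nat \<Rightarrow> 'a::banach) \<Rightarrow> ('a \<Rightarrow>\<^sub>L 'a) \<Rightarrow> bool" where
  "diagonal_operator e T \<longleftrightarrow> (\<forall>j m. m \<noteq> j \<longrightarrow> coord UNIV e m (T (e j)) = 0)"

definition identity_factors :: "real \<Rightarrow> ('a::banach \<Rightarrow>\<^sub>L 'a) \<Rightarrow> bool" where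
  "identity_factors c T \<longleftrightarrow>
     (\<exists>A B :: 'a \<Rightarrow>\<^sub>L 'a. norm A * norm B \<le> c \<and> id_blinfun = A o\<^sub>L T o\<^sub>L B)"

definition identity_almost_factors :: "real \<Rightarrow> ('a::banach \<Rightarrow>\<^sub>L 'a) \<Rightarrow> bool" where
  "identity_almost_factors c T \<longleftrightarrow> (\<forall>\<epsilon>>0. identity_factors (c + \<epsilon>) T)"

definition diagonal_factorization_property ::
    "(real \<Rightarrow> real) \<Rightarrow> (nat \<Rightarrow> 'a::banach) \<Rightarrow> bool" where
  "diagonal_factorization_property K e \<longleftrightarrow>
     (\<forall>\<delta>>0. \<forall>T :: 'a \<Rightarrow>\<^sub>L 'a.
        diagonal_operator e T \<and> (INF j. \<bar>coord UNIV e j (T (e j))\<bar>) \<ge> \<delta> \<longrightarrow>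
        identity_almost_factors (K \<delta>) T)"

text \<open>
  Impartial equivalence of two sequences, each given through the function sending a finitely
  supported coefficient sequence to the norm of the corresponding linear combination.
\<close>

definition impartially_equivalent ::
    "real \<Rightarrow> ((nat \<Rightarrow> real) \<Rightarrow> real) \<Rightarrow> ((nat \<Rightarrow> real) \<Rightarrow> real) \<Rightarrow> bool" where
  "impartially_equivalent C p q \<longleftrightarrow>
     (\<forall>a. finite {i. a i \<noteq> 0} \<longrightarrow> 1 / sqrt C * q a \<le> p a \<and> p a \<le> sqrt C * q a)"

definition comb_norm :: "(nat \<Rightarrow> 'a::real_normed_vector) \<Rightarrow> (nat \<Rightarrow> real) \<Rightarrow> real" where
  "comb_norm x a = norm (\<Sum>i | a i \<noteq> 0. a i *\<^sub>R x i)"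

definition dual_comb_norm ::
    "(nat \<Rightarrow> 'a::real_normed_vector \<Rightarrow> real) \<Rightarrow> (nat \<Rightarrow> real) \<Rightarrow> real" where
  "dual_comb_norm f a = onorm (\<lambda>v. \<Sum>i | a i \<noteq> 0. a i * f i v)"


section \<open>Strategic reproducibility\<close>

datatype 'a challenge =
  Challenge (tol: real) (space_part: "'a set") (dual_part: "('a \<Rightarrow> real) set")

datatype response =
  Response (side: nat) (supp: "nat set") (lam: "nat \<Rightarrow> real") (mu: "nat \<Rightarrow> real")

text \<open>
  A strategy of Player II maps the partition, the challenges of Player I up to and including the
  current turn, and the signs chosen by Player I in the previous turns, to a response. The earlier
  moves of Player II are determined by these data.
\<close>

type_synonym 'a strategy =
  "nat set \<times> nat set \<Rightarrow> 'a challenge list \<Rightarrow> (nat \<Rightarrow> real) list \<Rightarrow> response"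

definition reply ::
    "'a strategy \<Rightarrow> nat set \<times> nat set \<Rightarrow> (nat \<Rightarrow> 'a challenge) \<Rightarrow> (nat \<Rightarrow> nat \<Rightarrow> real) \<Rightarrow>
     nat \<Rightarrow> response" where
  "reply \<sigma> P ch sg n = \<sigma> P (map ch [0..<Suc n]) (map sg [0..<n])"

definition legal_challenge :: "'a::real_normed_vector set \<Rightarrow> 'a challenge \<Rightarrow> bool" where
  "legal_challenge S c \<longleftrightarrow> tol c > 0 \<and> space_part c \<in> cof S \<and> dual_part c \<in> cof_wstar S"

definition legal_response :: "real \<Rightarrow> nat set \<times> nat set \<Rightarrow> response \<Rightarrow> bool" where
  "legal_response \<eta> P r \<longleftrightarrow>
     side r \<in> {1, 2} \<and> finite (supp r) \<and>
     supp r \<subseteq> (if side r = 1 then fst P else snd P) \<and>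
     (\<forall>i\<in>supp r. lam r i \<ge> 0 \<and> mu r i \<ge> 0) \<and>
     1 - \<eta> < (\<Sum>i\<in>supp r. lam r i * mu r i) \<and>
     (\<Sum>i\<in>supp r. lam r i * mu r i) < 1 + \<eta>"

definition block_vector ::
    "(nat \<Rightarrow> 'a::real_normed_vector) \<Rightarrow> response \<Rightarrow> (nat \<Rightarrow> real) \<Rightarrow> 'a" where
  "block_vector e r s = (\<Sum>i\<in>supp r. (s i * lam r i) *\<^sub>R e i)"

definition block_functional ::
    "'a::real_normed_vector set \<Rightarrow> (nat \<Rightarrow> 'a) \<Rightarrow> response \<Rightarrow> (nat \<Rightarrow> real) \<Rightarrow> 'a \<Rightarrow> real" where
  "block_functional S e r s v = (\<Sum>i\<in>supp r. s i * mu r i * coord S e i v)"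

text \<open>
  The signs of turn \<open>n\<close> are required to be extensional functions on the support chosen by
  Player II, so that they carry no information beyond an element of \<open>{-1, 1}\<^sup>E\<close>.
\<close>

definition winning_strategy ::
    "'a::real_normed_vector set \<Rightarrow> (nat \<Rightarrow> 'a) \<Rightarrow> real \<Rightarrow> real \<Rightarrow> 'a strategy \<Rightarrow> bool" where
  "winning_strategy S e C \<eta> \<sigma> \<longleftrightarrow>
     (\<forall>N\<^sub>1 N\<^sub>2 ch sg.
        N\<^sub>1 \<union> N\<^sub>2 = UNIV \<and> N\<^sub>1 \<inter> N\<^sub>2 = {} \<and>
        (\<forall>n. legal_challenge S (ch n)) \<and>
        (\<forall>n. sg n \<in> supp (reply \<sigma> (N\<^sub>1, N\<^sub>2) ch sg n) \<rightarrow>\<^sub>E {-1, 1}) \<longrightarrow>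
        (let r = reply \<sigma> (N\<^sub>1, N\<^sub>2) ch sg;
             x = (\<lambda>n. block_vector e (r n) (sg n));
             x' = (\<lambda>n. block_functional S e (r n) (sg n))
         in (\<forall>n. legal_response \<eta> (N\<^sub>1, N\<^sub>2) (r n)) \<and>
            impartially_equivalent (C + \<eta>) (comb_norm x) (comb_norm e) \<and>
            impartially_equivalent (C + \<eta>) (dual_comb_norm x') (dual_comb_norm (coord S e)) \<and>
            (\<forall>n. infdist (x n) (space_part (ch n)) < tol (ch n)) \<and>
            (\<forall>n. dual_infdist (x' n) (dual_part (ch n)) < tol (ch n))))"

definition strategically_reproducible ::
    "real \<Rightarrow> 'a::real_normed_vector set \<Rightarrow> (nat \<Rightarrow> 'a) \<Rightarrow> bool" where
  "strategically_reproducible C S e \<longleftrightarrow>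
     normalized_schauder_basis S e \<and> (\<forall>\<eta>>0. \<exists>\<sigma>. winning_strategy S e C \<eta> \<sigma>)"


section \<open>The space of bounded sequences\<close>

text \<open>
  Since \<open>nat\<close> is discrete, \<open>nat \<Rightarrow>\<^sub>C 'a\<close> is the space of all bounded sequences in \<open>'a\<close>, with the
  supremum norm. It is complete for Banach \<open>'a\<close>, but has no \<open>banach\<close> instance because \<open>nat\<close> is not
  an instance of \<open>metric_space\<close>.
\<close>

type_synonym 'a linf = "nat \<Rightarrow>\<^sub>C 'a"

definition single :: "nat \<Rightarrow> 'a \<Rightarrow> 'a::banach linf" where
  "single k x = Bcontfun (\<lambda>i. if i = k then x else 0)"

lemma apply_single: "apply_bcontfun (single k x) i = (if i = k then x else 0)"
proof -
  have "range (\<lambda>i. if i = k then x else 0) \<subseteq> {x, 0}" by auto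
  then have "(\<lambda>i. if i = k then x else 0) \<in> bcontfun"
    by (auto simp: bcontfun_def intro: finite_imp_bounded finite_subset)
  then show ?thesis
    by (simp add: single_def Bcontfun_inverse)
qed

definition component :: "nat \<Rightarrow> 'a::banach linf set" where
  "component k = {z. \<forall>i. i \<noteq> k \<longrightarrow> apply_bcontfun z i = 0}"

definition array :: "(nat \<Rightarrow> 'a) \<Rightarrow> nat \<Rightarrow> nat \<Rightarrow> 'a::banach linf" where
  "array e k j = single k (e j)"

definition array_coord :: "(nat \<Rightarrow> 'a) \<Rightarrow> nat \<Rightarrow> nat \<Rightarrow> 'a::banach linf \<Rightarrow> real" where
  "array_coord e k j z = coord UNIV e j (apply_bcontfun z k)"

definition simultaneously_strategically_reproducible ::
    "real \<Rightarrow> (nat \<Rightarrow> nat \<Rightarrow> 'a::banach linf) \<Rightarrow> bool" where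
  "simultaneously_strategically_reproducible C E \<longleftrightarrow>
     (\<forall>k. strategically_reproducible C (component k) (E k))"

end

theory Submission
  imports Defs
begin

text \<open>
  The first claim is a transport of structure: \<open>x \<mapsto> single k x\<close> is an isometry of \<open>X\<close> onto the \<open>k\<close>-th
  component that carries the basis to the basis, and along which cofinite dimensional subspaces and
  \<open>w\<^sup>*\<close>-closed cofinite dimensional subspaces of the dual pull back to such subspaces. Hence a strategy for \<open>X\<close> answers the
  challenges posed in the component (\<open>strategically_reproducible_component\<close>).

  For the factorization of \<open>T\<close> the difficulty is that an operator on \<open>\<ell>\<^sup>\<infinity>(X)\<close> is not determined by its
  matrix \<open>T\<^sub>k\<^sub>l : X \<rightarrow> X\<close>: it may be non-zero and vanish on all finitely supported sequences. So one
  first passes to an infinite set of components on which no coordinate functional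
  \<open>e\<^sup>*\<^sub>(\<^sub>k\<^sub>,\<^sub>j\<^sub>) \<circ> T\<close> has a singular part. Each of these countably many functionals has a non-trivial
  singular part on at most countably many members of an almost disjoint family of index sets, and
  there is an uncountable such family. As all components are copies of \<open>X\<close>, the compression
  of \<open>T\<close> to the surviving components is again an operator on \<open>\<ell>\<^sup>\<infinity>(X)\<close> with large diagonal, and the
  identity factors through \<open>T\<close> if it factors through the compression (\<open>compression_to_tail_null\<close>).

  Next the games in all components are played in one interleaved sequence. Player I partitions
  the basis of a component according to the sign of the diagonal entries of \<open>T\<close>. Each subspace
  challenge asks the new block to be almost annihilated by the pull-backs under \<open>T\<close> of all earlier
  block functionals, and the new block functional to almost annihilate the images under \<open>T\<close> of all
  earlier block vectors. The signs are chosen such that the new diagonal entry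
  \<open>x\<^sup>*(T x)\<close> is in modulus at least as large as its average over all signs, which is
  \<open>\<Sum>\<lambda>\<^sub>i \<mu>\<^sub>i e\<^sub>i\<^sup>*(T e\<^sub>i)\<close> (\<open>play_outcome\<close>). The strategy of Player II makes \<open>B z = \<Sum> e\<^sub>j\<^sup>*(z) x\<^sub>j\<close> and
  \<open>A z = \<Sum> x\<^sub>j\<^sup>*(z) e\<^sub>j\<close>, taken in each component, bounded operators
  (\<open>block_synthesis\<close>, \<open>block_analysis\<close>).

  Because the functionals are order continuous, \<open>A T B\<close> differs from the componentwise diagonal
  operator \<open>D\<close> with entries \<open>x\<^sup>*\<^sub>(\<^sub>k\<^sub>,\<^sub>j\<^sub>)(T x\<^sub>(\<^sub>k\<^sub>,\<^sub>j\<^sub>))\<close> by an operator whose norm is at most a constant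
  times the sum of the off-diagonal entries, hence as small as desired
  (\<open>off_diagonal_estimate\<close>). The diagonal factorization property applies in each component with a
  constant independent of the component, so the identity factors through \<open>D\<close> with a bound fixed
  before the game starts, and a Neumann series absorbs the perturbation.

  Two classical facts about the basis enter: the basis projections are uniformly bounded
  (\<open>psum_uniformly_bounded\<close>), and vectors in the span of finitely many basis vectors are normed by
  functionals there (\<open>norming_coefficients\<close>).
\<close>

section \<open>Uniform boundedness of the basis projections\<close>

locale schauder =
  fixes e :: "nat \<Rightarrow> 'a::banach"
  assumes basis: "normalized_schauder_basis UNIV e"
begin

abbreviation cf :: "nat \<Rightarrow> 'a \<Rightarrow> real" where "cf \<equiv> coord UNIV e"

definition psum :: "nat \<Rightarrow> 'a \<Rightarrow> 'a" where
  "psum N x = (\<Sum>j<N. cf j x *\<^sub>R e j)"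

lemma norm_basis [simp]: "norm (e j) = 1"
  using basis by (simp add: normalized_schauder_basis_def)

lemma expansion_ex1: "\<exists>!a. (\<lambda>j. a j *\<^sub>R e j) sums x"
  using basis by (simp add: normalized_schauder_basis_def)

lemma cf_sums: "(\<lambda>j. cf j x *\<^sub>R e j) sums x"
  using theI'[OF expansion_ex1[of x]] by (simp add: coord_def)

lemma cf_unique: "(\<lambda>j. a j *\<^sub>R e j) sums x \<Longrightarrow> cf j x = a j"
  using the1_equality[OF expansion_ex1[of x], of a] by (simp add: coord_def)

lemma cf_add: "cf j (x + y) = cf j x + cf j y"
  by (rule cf_unique) (use sums_add[OF cf_sums[of x] cf_sums[of y]] in \<open>simp add: scaleR_left_distrib\<close>)

lemma cf_scaleR: "cf j (c *\<^sub>R x) = c * cf j x"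
  by (rule cf_unique) (use sums_scaleR_right[OF cf_sums[of x], of c] in simp)

lemma linear_cf: "linear (cf j)"
  by (rule linearI) (simp_all add: cf_add cf_scaleR)

lemmas cf_sum = linear_sum[OF linear_cf]

lemma cf_basis: "cf j (e i) = (if j = i then 1 else 0)"
  by (rule cf_unique) (use sums_single[of i e] in \<open>simp add: if_distrib[of "\<lambda>c. c *\<^sub>R _"] if_distribR cong: if_cong\<close>)

lemma linear_psum: "linear (psum N)"
  by (rule linearI) (simp_all add: psum_def cf_add cf_scaleR scaleR_left_distrib sum.distrib scaleR_sum_right)

lemmas psum_diff = linear_diff[OF linear_psum]
  and psum_scaleR = linear_scale[OF linear_psum]

lemma psum_tendsto: "(\<lambda>N. psum N x) \<longlonglongrightarrow> x"
  using cf_sums[of x] by (simp add: psum_def sums_def)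

lemma cf_eq_psum_diff: "cf j x *\<^sub>R e j = psum (Suc j) x - psum j x"
  by (simp add: psum_def)

lemma abs_cf_le:
  assumes "\<And>N. norm (psum N x) \<le> c"
  shows "\<bar>cf j x\<bar> \<le> 2 * c"
proof -
  have "\<bar>cf j x\<bar> = norm (psum (Suc j) x - psum j x)"
    by (simp flip: cf_eq_psum_diff)
  also have "\<dots> \<le> norm (psum (Suc j) x) + norm (psum j x)"
    by (rule norm_triangle_ineq4)
  finally show ?thesis using assms[of "Suc j"] assms[of j] by linarith
qed

text \<open>
  The quantity \<open>sup\<^sub>N \<parallel>psum N x\<parallel>\<close> behaves like a complete norm. The coordinates of the summands
  add up to a coefficient sequence, whose partial sums converge to \<open>y\<close> by dominated
  convergence; uniqueness of the expansion then identifies them with those of \<open>y\<close>.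
\<close>

lemma psum_bound_of_series:
  fixes x :: "nat \<Rightarrow> 'a"
  assumes sums: "x sums y" and b: "\<And>k N. norm (psum N (x k)) \<le> c k" and c: "summable c"
  shows "norm (psum N y) \<le> suminf c"
proof -
  have cf_le: "\<bar>cf j (x k)\<bar> \<le> 2 * c k" for j k
    by (rule abs_cf_le) (rule b)
  have sum_cf: "summable (\<lambda>k. cf j (x k))" for j
    by (rule summable_comparison_test'[of "\<lambda>k. 2 * c k" 0]) (use c cf_le in auto)
  define a where "a j = (\<Sum>k. cf j (x k))" for j
  define Y where "Y N = (\<Sum>k. psum N (x k))" for N
  have sum_norm: "summable (\<lambda>k. norm (psum N (x k)))" for N
    by (rule summable_comparison_test'[of c 0]) (use c b in auto)
  have sum_ps: "summable (\<lambda>k. psum N (x k))" for N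
    by (rule summable_norm_cancel[OF sum_norm])
  have Y_eq: "Y N = (\<Sum>j<N. a j *\<^sub>R e j)" for N
  proof -
    have "Y N = (\<Sum>k. \<Sum>j<N. cf j (x k) *\<^sub>R e j)"
      by (simp add: Y_def psum_def)
    also have "\<dots> = (\<Sum>j<N. \<Sum>k. cf j (x k) *\<^sub>R e j)"
      by (rule suminf_sum) (auto intro!: summable_scaleR_left sum_cf)
    also have "\<dots> = (\<Sum>j<N. a j *\<^sub>R e j)"
      by (simp add: a_def suminf_scaleR_left[OF sum_cf])
    finally show ?thesis .
  qed
  have norm_Y: "norm (Y N) \<le> suminf c" for N
    unfolding Y_def
    by (rule order_trans[OF summable_norm[OF sum_norm] suminf_le[OF b sum_norm c]])
  have norm_x: "norm (x k) \<le> c k" for k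
    by (rule Lim_bounded[OF tendsto_norm[OF psum_tendsto]]) (use b in auto)
  have "(\<lambda>N. norm (y - Y N)) \<longlonglongrightarrow> 0"
  proof (rule Lim_null_comparison)
    show "\<forall>\<^sub>F N in sequentially. norm (norm (y - Y N)) \<le> (\<Sum>k. norm (x k - psum N (x k)))"
    proof (rule always_eventually, rule allI)
      fix N
      have dom: "norm (x k - psum N (x k)) \<le> 2 * c k" for k
        using norm_triangle_ineq4[of "x k" "psum N (x k)"] norm_x[of k] b[of N k] by linarith
      have s: "summable (\<lambda>k. norm (x k - psum N (x k)))"
        by (rule summable_comparison_test'[of "\<lambda>k. 2 * c k" 0]) (use c dom in auto)
      have "y - Y N = (\<Sum>k. x k - psum N (x k))"
        using suminf_diff[OF sums_summable[OF sums] sum_ps[of N]] sums_unique[OF sums]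
        by (simp add: Y_def)
      then show "norm (norm (y - Y N)) \<le> (\<Sum>k. norm (x k - psum N (x k)))"
        using summable_norm[OF s] by simp
    qed
    show "(\<lambda>N. \<Sum>k. norm (x k - psum N (x k))) \<longlonglongrightarrow> 0"
    proof -
      have "((\<lambda>N. \<Sum>k. norm (x k - psum N (x k))) \<longlongrightarrow> (\<Sum>k. (0::real))) sequentially"
      proof (rule tannerys_theorem[where M = "\<lambda>k. 2 * c k", THEN conjunct2, THEN conjunct2])
        show "(\<lambda>N. norm (x k - psum N (x k))) \<longlonglongrightarrow> 0" for k
          using tendsto_norm[OF tendsto_diff[OF tendsto_const[of "x k"] psum_tendsto[of "x k"]]] by simp
        have "norm (norm (x k - psum N (x k))) \<le> 2 * c k" for k N
          using norm_triangle_ineq4[of "x k" "psum N (x k)"] norm_x[of k] b[of N k] by simp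
        then show "\<forall>\<^sub>F (k, N) in sequentially \<times>\<^sub>F sequentially.
            norm (norm (x k - psum N (x k))) \<le> 2 * c k"
          by (intro always_eventually) auto
      qed (use c in auto)
      then show ?thesis by simp
    qed
  qed
  then have "(\<lambda>N. Y N - y) \<longlonglongrightarrow> 0"
    by (subst tendsto_norm_zero_iff[symmetric]) (simp add: norm_minus_commute)
  then have "Y \<longlonglongrightarrow> y" by (rule LIM_zero_cancel)
  then have "(\<lambda>j. a j *\<^sub>R e j) sums y"
    unfolding sums_def Y_eq[symmetric] .
  then have "cf j y = a j" for j
    by (rule cf_unique)
  then have "psum N y = Y N"
    by (simp add: psum_def Y_eq)
  then show ?thesis using norm_Y by simp
qed

text \<open>
  For each \<open>y\<close> the convergent sequence \<open>psum N y\<close> is bounded, so the level sets for all \<open>n\<close> cover \<open>X\<close>,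
  and one of their closures has interior by Baire's theorem.
\<close>

lemma psum_level_somewhere_dense:
  obtains n :: nat and x r where "0 < r" "ball x r \<subseteq> closure {y. \<forall>N. norm (psum N y) \<le> n}"
proof -
  define V where "V n = {y. \<forall>N. norm (psum N y) \<le> real n}" for n
  have UN: "(\<Union>n. V n) = UNIV"
  proof -
    have "\<exists>n. y \<in> V n" for y
    proof -
      have "Bseq (\<lambda>N. psum N y)"
        using psum_tendsto convergentI convergent_imp_Bseq by blast
      then obtain c where "\<And>N. norm (psum N y) \<le> c" by (auto simp: Bseq_def)
      moreover obtain n :: nat where "c \<le> n" using real_arch_simple by blast
      ultimately show ?thesis unfolding V_def by (blast intro: order_trans)
    qed
    then show ?thesis by blast
  qed
  have "\<exists>n. interior (closure (V n)) \<noteq> {}"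
  proof (rule ccontr)
    assume "\<nexists>n. interior (closure (V n)) \<noteq> {}"
    then have empty: "interior (closure (V n)) = {}" for n by blast
    have "Met_TC.mtopology interior_of \<Union>(range (\<lambda>n. closure (V n))) = {}"
    proof (rule Met_TC.metric_Baire_category_alt)
      show "Met_TC.mcomplete TYPE('a)" by (simp add: complete_UNIV)
      fix W assume "W \<in> range (\<lambda>n. closure (V n))"
      then show "closedin Met_TC.mtopology W \<and> Met_TC.mtopology interior_of W = {}"
        using empty by auto
    qed simp
    moreover have "\<Union>(range (\<lambda>n. closure (V n))) = UNIV"
      using UN closure_subset by blast
    ultimately show False by simp
  qed
  then obtain n x where "x \<in> interior (closure (V n))" by blast
  then obtain r where "0 < r" "ball x r \<subseteq> closure (V n)"
    by (auto simp: mem_interior)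
  then show ?thesis using that unfolding V_def by blast
qed

text \<open>
  The level set is convex and symmetric, so differences of its points approximate the points of a ball
  around \<open>0\<close>; the rest is scaling.
\<close>

lemma psum_approximation:
  obtains c where "0 < c"
    "\<And>x d. 0 < d \<Longrightarrow> \<exists>y. norm (x - y) < d \<and> (\<forall>N. norm (psum N y) \<le> c * norm x)"
proof -
  obtain n :: nat and x0 r where r: "0 < r"
    and ball: "ball x0 r \<subseteq> closure {y. \<forall>N. norm (psum N y) \<le> n}"
    by (rule psum_level_somewhere_dense)
  define c where "c = 4 * real (Suc n) / r"
  have "0 < c" using r by (simp add: c_def)
  moreover have "\<exists>y. norm (x - y) < d \<and> (\<forall>N. norm (psum N y) \<le> c * norm x)"
    if d: "0 < d" for x d
  proof (cases "x = 0")
    case True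
    have "psum N 0 = 0" for N using linear_0[OF linear_psum] .
    then show ?thesis using True d by (intro exI[of _ 0]) simp
  next
    case False
    define t where "t = r / (2 * norm x)"
    have t: "t > 0" using False r by (simp add: t_def)
    have "norm (t *\<^sub>R x) < r" using False r by (simp add: t_def)
    then have "x0 + t *\<^sub>R x \<in> ball x0 r" "x0 \<in> ball x0 r"
      using r by (auto simp: dist_norm)
    have near: "\<exists>u. (\<forall>N. norm (psum N u) \<le> n) \<and> dist u p < t * d / 2"
      if "p \<in> ball x0 r" for p
    proof -
      have "p \<in> closure {y. \<forall>N. norm (psum N y) \<le> n}" using ball that by blast
      moreover have "t * d / 2 > 0" using t d by simp
      ultimately show ?thesis unfolding closure_approachable mem_Collect_eq by blast
    qed
    obtain u where u: "\<forall>N. norm (psum N u) \<le> n" "dist u (x0 + t *\<^sub>R x) < t * d / 2"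
      using near[OF \<open>x0 + t *\<^sub>R x \<in> ball x0 r\<close>] by blast
    obtain v where v: "\<forall>N. norm (psum N v) \<le> n" "dist v x0 < t * d / 2"
      using near[OF \<open>x0 \<in> ball x0 r\<close>] by blast
    define y where "y = (1 / t) *\<^sub>R (u - v)"
    have "norm (t *\<^sub>R x - (u - v)) = norm ((v - x0) - (u - (x0 + t *\<^sub>R x)))"
      by (simp add: algebra_simps)
    also have "\<dots> < t * d"
      using norm_triangle_ineq4[of "v - x0" "u - (x0 + t *\<^sub>R x)"] u(2) v(2)
      by (simp add: dist_norm)
    finally have "norm (t *\<^sub>R x - (u - v)) < t * d" .
    moreover have "t *\<^sub>R x - (u - v) = t *\<^sub>R (x - y)"
      using t by (simp add: y_def scaleR_diff_right)
    ultimately have "norm (x - y) < d" using t by simp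
    moreover have "norm (psum N y) \<le> c * norm x" for N
    proof -
      have "norm (psum N y) = (1 / t) * norm (psum N u - psum N v)"
        using t by (simp add: y_def psum_scaleR psum_diff)
      also have "norm (psum N u - psum N v) \<le> 2 * real (Suc n)"
        using norm_triangle_ineq4[of "psum N u" "psum N v"] spec[OF u(1), of N] spec[OF v(1), of N]
          by simp
      then have "(1 / t) * norm (psum N u - psum N v) \<le> (1 / t) * (2 * real (Suc n))"
        using t by (intro mult_left_mono) auto
      also have "\<dots> = c * norm x" by (simp add: t_def c_def)
      finally show ?thesis .
    qed
    ultimately show ?thesis by blast
  qed
  ultimately show ?thesis using that by blast
qed

text \<open>
  The iteration of the open mapping theorem: approximate \<open>x\<close>, then the remainder, and so on.
  The approximants form a series that converges to \<open>x\<close> and is dominated in the sense of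
  \<open>psum_bound_of_series\<close>.
\<close>

theorem psum_uniformly_bounded:
  obtains M where "1 \<le> M" "\<And>N x. norm (psum N x) \<le> M * norm x"
proof -
  obtain c where c: "0 < c"
    and approx: "\<And>x d. 0 < d \<Longrightarrow> \<exists>y. norm (x - y) < d \<and> (\<forall>N. norm (psum N y) \<le> c * norm x)"
    by (rule psum_approximation) (rule that)
  have bound: "norm (psum N x) \<le> 2 * c * norm x" for N x
  proof (cases "x = 0")
    case True
    then show ?thesis using linear_0[OF linear_psum] by simp
  next
    case False
    define q where "q k = norm x * (1/2) ^ k" for k
    have q: "q k > 0" for k using False by (simp add: q_def)
    \<comment> \<open>greedy approximation: \<open>z k\<close> is what remains of \<open>x\<close> after \<open>k\<close> steps\<close>
    have "\<forall>k z. \<exists>y. norm (z - y) < q (Suc k) \<and> (\<forall>N. norm (psum N y) \<le> c * norm z)"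
      using approx q by blast
    then obtain g where g: "\<And>k z. norm (z - g k z) < q (Suc k)"
      "\<And>k z N. norm (psum N (g k z)) \<le> c * norm z"
      by metis
    define z where "z = rec_nat x (\<lambda>k z. z - g k z)"
    have z0: "z 0 = x" and zS: "z (Suc k) = z k - g k (z k)" for k
      by (simp_all add: z_def)
    have zq: "norm (z k) \<le> q k" for k
      by (cases k) (use g(1) in \<open>auto simp: z0 zS q_def less_imp_le\<close>)
    define w where "w k = g k (z k)" for k
    have part: "(\<Sum>k<m. w k) = x - z m" for m
      by (induction m) (auto simp: z0 zS w_def)
    have "q \<longlonglongrightarrow> 0" unfolding q_def using tendsto_mult_right_zero[OF LIMSEQ_power_zero[of "1/2::real"], of "norm x"] by simp
    then have "z \<longlonglongrightarrow> 0"
      by (rule Lim_null_comparison[rotated]) (use zq in auto)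
    then have "w sums x"
      unfolding sums_def part using tendsto_diff[OF tendsto_const, of z 0 sequentially x] by simp
    moreover have "norm (psum N (w k)) \<le> c * q k" for k N
      unfolding w_def using order_trans[OF g(2)[of N k "z k"] mult_left_mono[OF zq[of k]]] c by simp
    moreover have "(\<lambda>k. c * q k) sums (c * (norm x * 2))"
      unfolding q_def using geometric_sums[of "1/2::real"] by (intro sums_mult) simp
    ultimately show ?thesis
      using psum_bound_of_series[of w x "\<lambda>k. c * q k" N]
      by (simp add: sums_iff mult_ac)
  qed
  have "norm (psum N x) \<le> max 1 (2 * c) * norm x" for N x
    by (rule order_trans[OF bound]) (intro mult_right_mono; simp)
  then show ?thesis using that[of "max 1 (2 * c)"] by simp
qed

lemma bounded_linear_cf: "bounded_linear (cf j)"
proof -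
  obtain M where M: "\<And>N x. norm (psum N x) \<le> M * norm x"
    by (rule psum_uniformly_bounded) (rule that)
  show ?thesis
    by (rule bounded_linear_intro[of _ "2 * M"])
      (use abs_cf_le[OF M] in \<open>auto simp: cf_add cf_scaleR mult_ac\<close>)
qed

end

section \<open>Block operators\<close>

text \<open>
  The Hahn-Banach theorem for the span of finitely many vectors. The number \<open>a j\<close> is the value at
  \<open>v j\<close> of a functional that norms \<open>v 0\<close>; the inequality for all \<open>c\<close> makes this functional well defined
  on the span and of norm at most 1. The induction step is the classical
  one-dimensional extension.
\<close>

lemma finite_norming_coefficients:
  fixes v :: "nat \<Rightarrow> 'b::real_normed_vector"
  shows "\<exists>a. a 0 = norm (v 0) \<and>
    (\<forall>c. (\<Sum>j<Suc n. c j * a j) \<le> norm (\<Sum>j<Suc n. c j *\<^sub>R v j))"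
proof (induction n)
  case 0
  show ?case
    by (rule exI[of _ "\<lambda>_. norm (v 0)"]) (simp add: mult_right_mono)
next
  case (Suc n)
  then obtain a where a0: "a 0 = norm (v 0)"
    and a: "\<And>c. (\<Sum>j<Suc n. c j * a j) \<le> norm (\<Sum>j<Suc n. c j *\<^sub>R v j)"
    by blast
  define L where "L c = (\<Sum>j<Suc n. c j * a j)" for c
  define V where "V c = (\<Sum>j<Suc n. c j *\<^sub>R v j)" for c
  define w where "w = v (Suc n)"
  have LV: "L c \<le> norm (V c)" for c using a by (simp add: L_def V_def)
  have L_add: "L (\<lambda>j. c j + d j) = L c + L d" for c d
    unfolding L_def by (simp only: distrib_right sum.distrib)
  have V_add: "V (\<lambda>j. c j + d j) = V c + V d" for c d
    unfolding V_def by (simp only: scaleR_left_distrib sum.distrib)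
  have L_scale: "L (\<lambda>j. r * c j) = r * L c" for r c
    unfolding L_def by (simp only: sum_distrib_left mult.assoc)
  have V_scale: "V (\<lambda>j. r * c j) = r *\<^sub>R V c" for r c
    unfolding V_def by (simp only: scaleR_sum_right scaleR_scaleR)
  have cross: "L c - norm (V c - w) \<le> norm (V d + w) - L d" for c d
  proof -
    have "L c + L d \<le> norm (V c + V d)"
      using LV[of "\<lambda>j. c j + d j"] by (simp only: L_add V_add)
    also have "V c + V d = (V c - w) + (V d + w)" by simp
    also have "norm \<dots> \<le> norm (V c - w) + norm (V d + w)" by (rule norm_triangle_ineq)
    finally show ?thesis by simp
  qed
  define t where "t = (SUP c. L c - norm (V c - w))"
  have bdd: "bdd_above (range (\<lambda>c. L c - norm (V c - w)))"
    by (rule bdd_aboveI2) (rule cross)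
  have lower: "L c - norm (V c - w) \<le> t" for c
    unfolding t_def by (rule cSUP_upper[OF _ bdd]) simp
  have upper: "t \<le> norm (V d + w) - L d" for d
    unfolding t_def by (rule cSUP_least) (simp_all add: cross)
  have ext: "L c + s * t \<le> norm (V c + s *\<^sub>R w)" for c s
  proof (cases s "0::real" rule: linorder_cases)
    case equal
    then show ?thesis using LV by simp
  next
    case greater
    have "V (\<lambda>j. (1 / s) * c j) + w = (1 / s) *\<^sub>R (V c + s *\<^sub>R w)"
      using greater by (simp only: V_scale) (simp add: scaleR_right_distrib)
    then have "t \<le> (1 / s) * norm (V c + s *\<^sub>R w) - (1 / s) * L c"
      using upper[of "\<lambda>j. (1 / s) * c j"] greater by (simp only: L_scale) simp
    then show ?thesis using greater by (simp add: field_simps)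
  next
    case less
    have "V (\<lambda>j. (- 1 / s) * c j) - w = (- 1 / s) *\<^sub>R (V c + s *\<^sub>R w)"
      using less by (simp only: V_scale) (simp add: scaleR_right_distrib)
    then have "norm (V (\<lambda>j. (- 1 / s) * c j) - w) = (- 1 / s) * norm (V c + s *\<^sub>R w)"
      using less by simp
    then have "(- 1 / s) * L c - (- 1 / s) * norm (V c + s *\<^sub>R w) \<le> t"
      using lower[of "\<lambda>j. (- 1 / s) * c j"] by (simp only: L_scale)
    then show ?thesis using less by (simp add: field_simps)
  qed
  show ?case
  proof (intro exI conjI allI)
    show "(a(Suc n := t)) 0 = norm (v 0)" using a0 by simp
    fix c
    have "(\<Sum>j<Suc (Suc n). c j * (a(Suc n := t)) j) = L c + c (Suc n) * t"
      unfolding L_def by (subst sum.lessThan_Suc) simp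
    moreover have "(\<Sum>j<Suc (Suc n). c j *\<^sub>R v j) = V c + c (Suc n) *\<^sub>R w"
      unfolding V_def w_def by (subst sum.lessThan_Suc) simp
    ultimately show "(\<Sum>j<Suc (Suc n). c j * (a(Suc n := t)) j)
        \<le> norm (\<Sum>j<Suc (Suc n). c j *\<^sub>R v j)"
      using ext[of c "c (Suc n)"] by simp
  qed
qed

text \<open>
  The vector to be normed is put in front of the family; applying the bound to both signs of the relation
  that expresses it by the others gives the equality.
\<close>

lemma norming_coefficients:
  fixes v :: "nat \<Rightarrow> 'b::real_normed_vector"
  obtains a where "(\<Sum>j<n. b j * a j) = norm (\<Sum>j<n. b j *\<^sub>R v j)"
    "\<And>c. \<bar>\<Sum>j<n. c j * a j\<bar> \<le> norm (\<Sum>j<n. c j *\<^sub>R v j)"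
proof -
  define y where "y = (\<Sum>j<n. b j *\<^sub>R v j)"
  define u where "u j = (case j of 0 \<Rightarrow> y | Suc i \<Rightarrow> v i)" for j
  obtain a where a0: "a 0 = norm y"
    and a: "\<And>c. (\<Sum>j<Suc n. c j * a j) \<le> norm (\<Sum>j<Suc n. c j *\<^sub>R u j)"
    using finite_norming_coefficients[of u n] by (auto simp: u_def)
  have split: "c0 * norm y + (\<Sum>j<n. c j * a (Suc j)) \<le> norm (c0 *\<^sub>R y + (\<Sum>j<n. c j *\<^sub>R v j))"
    for c0 c
    using a[of "case_nat c0 c"] unfolding sum.lessThan_Suc_shift by (simp add: u_def a0)
  have "norm y = (\<Sum>j<n. b j * a (Suc j))"
    using split[of 1 "\<lambda>j. - b j"] split[of "-1" b]
    by (simp add: sum_negf y_def)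
  moreover have "\<bar>\<Sum>j<n. c j * a (Suc j)\<bar> \<le> norm (\<Sum>j<n. c j *\<^sub>R v j)" for c
    using split[of 0 c] split[of 0 "\<lambda>j. - c j"] by (simp add: sum_negf)
  ultimately show ?thesis
    using that[of "\<lambda>j. a (Suc j)"] by (simp add: y_def)
qed

lemma comb_norm_on:
  assumes "finite F"
  shows "comb_norm x (\<lambda>j. if j \<in> F then b j else 0) = norm (\<Sum>j\<in>F. b j *\<^sub>R x j)"
proof -
  have "(\<Sum>i | (if i \<in> F then b i else 0) \<noteq> 0. (if i \<in> F then b i else 0) *\<^sub>R x i)
      = (\<Sum>j\<in>F. b j *\<^sub>R x j)"
    by (rule sum.mono_neutral_cong_left) (use assms in \<open>auto split: if_splits\<close>)
  then show ?thesis by (simp add: comb_norm_def)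
qed

lemma dual_comb_norm_on:
  assumes "finite F"
  shows "dual_comb_norm f (\<lambda>j. if j \<in> F then b j else 0) = onorm (\<lambda>v. \<Sum>j\<in>F. b j * f j v)"
proof -
  have "(\<Sum>i | (if i \<in> F then b i else 0) \<noteq> 0. (if i \<in> F then b i else 0) * f i v)
      = (\<Sum>j\<in>F. b j * f j v)" for v
    by (rule sum.mono_neutral_cong_left) (use assms in \<open>auto split: if_splits\<close>)
  then show ?thesis by (simp add: dual_comb_norm_def)
qed

lemma finite_support_on: "finite F \<Longrightarrow> finite {j. (if j \<in> F then b j else 0) \<noteq> (0::real)}"
  by (rule finite_subset[of _ F]) auto

context schauder
begin

text \<open>
  Domination by the basis passes the Cauchy property of the basis expansion on to the block
  series.
\<close>

lemma block_synthesis: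
  fixes x :: "nat \<Rightarrow> 'a"
  assumes dom: "\<And>a. finite {i. a i \<noteq> 0} \<Longrightarrow> comb_norm x a \<le> c * comb_norm e a"
  obtains B where "bounded_linear B" "\<And>z. norm (B z) \<le> c * norm z"
    "\<And>z. (\<lambda>j. cf j z *\<^sub>R x j) sums B z"
proof -
  have fin: "norm (\<Sum>j\<in>F. b j *\<^sub>R x j) \<le> c * norm (\<Sum>j\<in>F. b j *\<^sub>R e j)" if "finite F" for F b
    using dom[OF finite_support_on[OF that, of b]] by (simp add: comb_norm_on that)
  have c: "0 \<le> c"
  proof -
    have "0 \<le> norm (\<Sum>j\<in>{0::nat}. 1 *\<^sub>R x j)" by simp
    also have "\<dots> \<le> c" using fin[of "{0}" "\<lambda>_. 1"] by simp
    finally show ?thesis .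
  qed
  have summ: "summable (\<lambda>j. cf j z *\<^sub>R x j)" for z
    unfolding summable_Cauchy
  proof (intro allI impI)
    fix r :: real assume r: "0 < r"
    then have "r / (c + 1) > 0" using c by simp
    moreover have "summable (\<lambda>j. cf j z *\<^sub>R e j)" using cf_sums sums_summable by blast
    ultimately obtain N where N: "\<And>m n. N \<le> m \<Longrightarrow> norm (\<Sum>j = m..<n. cf j z *\<^sub>R e j) < r / (c + 1)"
      unfolding summable_Cauchy by blast
    have "norm (\<Sum>j = m..<n. cf j z *\<^sub>R x j) < r" if "N \<le> m" for m n
    proof -
      have "norm (\<Sum>j = m..<n. cf j z *\<^sub>R x j) \<le> c * norm (\<Sum>j = m..<n. cf j z *\<^sub>R e j)"
        by (rule fin) simp
      also have "\<dots> \<le> c * (r / (c + 1))"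
        using N[OF that, of n] c by (intro mult_left_mono) auto
      also have "\<dots> < r" using c r by (simp add: field_simps)
      finally show ?thesis .
    qed
    then show "\<exists>N. \<forall>m\<ge>N. \<forall>n. norm (\<Sum>j = m..<n. cf j z *\<^sub>R x j) < r" by blast
  qed
  define B where "B z = (\<Sum>j. cf j z *\<^sub>R x j)" for z
  have sums: "(\<lambda>j. cf j z *\<^sub>R x j) sums B z" for z
    unfolding B_def by (rule summable_sums[OF summ])
  have norm: "norm (B z) \<le> c * norm z" for z
  proof (rule LIMSEQ_le)
    show "(\<lambda>N. norm (\<Sum>j<N. cf j z *\<^sub>R x j)) \<longlonglongrightarrow> norm (B z)"
      using sums[of z] unfolding sums_def by (rule tendsto_norm)
    show "(\<lambda>N. c * norm (psum N z)) \<longlonglongrightarrow> c * norm z"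
      by (intro tendsto_intros psum_tendsto)
    show "\<exists>N. \<forall>n\<ge>N. norm (\<Sum>j<n. cf j z *\<^sub>R x j) \<le> c * norm (psum n z)"
      unfolding psum_def by (intro exI allI impI fin) simp
  qed
  have "B (y + z) = B y + B z" for y z
    by (rule sums_unique2[OF sums]) (use sums_add[OF sums[of y] sums[of z]] in \<open>simp add: cf_add scaleR_left_distrib\<close>)
  moreover have "B (r *\<^sub>R z) = r *\<^sub>R B z" for r z
    by (rule sums_unique2[OF sums]) (use sums_scaleR_right[OF sums[of z], of r] in \<open>simp add: cf_scaleR\<close>)
  ultimately have "bounded_linear B"
    by (rule bounded_linear_intro[where K = c]) (use norm in \<open>simp add: mult.commute\<close>)
  then show ?thesis by (rule that[OF _ norm sums])
qed

text \<open>
  Dual to \<open>block_synthesis\<close>. A partial sum \<open>\<Sum>\<^sub>i\<^sub><\<^sub>N f i z e i\<close> is normed by a functional \<open>b\<close> on the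
  span of \<open>e 0, \<dots>, e (N - 1)\<close>. Since \<open>b \<circ> psum N\<close> has norm at most \<open>M\<close>, domination in the dual bounds
  \<open>\<Sum>\<^sub>i\<^sub><\<^sub>N b i f i\<close>, hence the partial sums are uniformly bounded operators. They converge on the basis
  vectors by absolute summability, and therefore everywhere.
\<close>

lemma block_analysis:
  fixes f :: "nat \<Rightarrow> 'a \<Rightarrow> real"
  assumes lin: "\<And>i. bounded_linear (f i)"
    and dom: "\<And>a. finite {i. a i \<noteq> 0} \<Longrightarrow> dual_comb_norm f a \<le> c * dual_comb_norm cf a"
    and M: "\<And>N x. norm (psum N x) \<le> M * norm x"
    and c: "0 \<le> c"
    and abs_summ: "\<And>j. summable (\<lambda>i. \<bar>f i (e j)\<bar>)"
  obtains A where "bounded_linear A" "\<And>z. norm (A z) \<le> c * M * norm z"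
    "\<And>z. (\<lambda>i. f i z *\<^sub>R e i) sums A z"
proof -
  define S where "S N z = (\<Sum>i<N. f i z *\<^sub>R e i)" for N z
  have linS: "bounded_linear (S N)" for N
    unfolding S_def by (intro bounded_linear_sum bounded_linear_scaleR_const lin)
  note S_diff = linear_diff[OF bounded_linear.linear[OF linS]]
  have norm_S: "norm (S N z) \<le> c * M * norm z" for N z
  proof -
    obtain b where b: "(\<Sum>j<N. f j z * b j) = norm (S N z)"
      and b_le: "\<And>d. \<bar>\<Sum>j<N. d j * b j\<bar> \<le> norm (\<Sum>j<N. d j *\<^sub>R e j)"
      unfolding S_def using norming_coefficients[where n = N and b = "\<lambda>j. f j z" and v = e] by blast
    have lin': "bounded_linear (\<lambda>v. \<Sum>j<N. b j * f j v)"
      by (intro bounded_linear_sum bounded_linear_const_mult lin)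
    have "norm (S N z) = (\<Sum>j<N. b j * f j z)"
      using b by (simp add: mult.commute)
    also have "\<dots> \<le> onorm (\<lambda>v. \<Sum>j<N. b j * f j v) * norm z"
      using onorm[OF lin', of z] by simp
    also have "onorm (\<lambda>v. \<Sum>j<N. b j * f j v) \<le> c * onorm (\<lambda>v. \<Sum>j<N. b j * cf j v)"
      using dom[OF finite_support_on[of "{..<N}" b]] dual_comb_norm_on[of "{..<N}" f b]
        dual_comb_norm_on[of "{..<N}" cf b] by simp
    also have "onorm (\<lambda>v. \<Sum>j<N. b j * cf j v) \<le> M"
    proof (rule onorm_bound)
      show "0 \<le> M" using M[of 0 "e 0"] by (simp add: psum_def)
      fix v
      show "norm (\<Sum>j<N. b j * cf j v) \<le> M * norm v"
        using b_le[of "\<lambda>j. cf j v"] M[of N v] by (simp add: psum_def mult.commute)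
    qed
    finally show ?thesis using c by (simp add: mult_left_mono mult_right_mono)
  qed
  have cM: "0 \<le> c * M"
    using norm_S[of 0 "e 0"] by (simp add: S_def)
  have conv_basis: "convergent (\<lambda>N. S N (e j))" for j
  proof -
    have "summable (\<lambda>i. f i (e j) *\<^sub>R e i)"
      by (rule summable_norm_cancel) (use abs_summ in simp)
    then show ?thesis by (simp add: S_def summable_iff_convergent)
  qed
  have conv_psum: "convergent (\<lambda>N. S N (psum m z))" for m z
  proof -
    have "S N (psum m z) = (\<Sum>j<m. cf j z *\<^sub>R S N (e j))" for N
      unfolding psum_def using bounded_linear.linear[OF linS[of N]]
      by (simp add: linear_sum linear_scale)
    moreover have "(\<lambda>N. \<Sum>j<m. cf j z *\<^sub>R S N (e j)) \<longlonglongrightarrow> (\<Sum>j<m. cf j z *\<^sub>R lim (\<lambda>N. S N (e j)))"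
      by (intro tendsto_intros) (use conv_basis in \<open>simp add: convergent_LIMSEQ_iff\<close>)
    ultimately show ?thesis by (auto intro: convergentI)
  qed
  have Cauchy: "Cauchy (\<lambda>N. S N z)" for z
  proof (rule metric_CauchyI)
    fix r :: real assume r: "0 < r"
    define q where "q = r / 3 / (c * M + 1)"
    have "q > 0" using r cM by (simp add: q_def)
    then obtain m where m: "norm (z - psum m z) < q"
      using psum_tendsto[of z] unfolding lim_sequentially by (metis dist_norm norm_minus_commute order_refl)
    have "Cauchy (\<lambda>N. S N (psum m z))" using conv_psum by (rule convergent_Cauchy)
    then obtain N where N: "\<And>k n. k \<ge> N \<Longrightarrow> n \<ge> N \<Longrightarrow> dist (S k (psum m z)) (S n (psum m z)) < r / 3"
      using r by (metis metric_CauchyD divide_pos_pos zero_less_numeral)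
    have near: "dist (S k z) (S k (psum m z)) < r / 3" for k
    proof -
      have "dist (S k z) (S k (psum m z)) \<le> c * M * norm (z - psum m z)"
        using norm_S[of k "z - psum m z"] by (simp add: dist_norm S_diff)
      also have "\<dots> \<le> c * M * q" using m cM by (intro mult_left_mono) auto
      also have "\<dots> < (c * M + 1) * q" using \<open>q > 0\<close> by simp
      also have "\<dots> = r / 3" 
      proof -
        have "c * M + 1 \<noteq> 0" using cM by linarith
        then show ?thesis unfolding q_def by (metis nonzero_mult_div_cancel_left times_divide_eq_right)
      qed
      finally show ?thesis .
    qed
    have "dist (S k z) (S n z) < r" if "k \<ge> N" "n \<ge> N" for k n
      using near[of k] near[of n] N[OF that]
        dist_triangle[of "S k z" "S n z" "S k (psum m z)"]
        dist_triangle2[of "S k (psum m z)" "S n z" "S n (psum m z)"]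
      by linarith
    then show "\<exists>N. \<forall>k\<ge>N. \<forall>n\<ge>N. dist (S k z) (S n z) < r" by blast
  qed
  define A where "A z = lim (\<lambda>N. S N z)" for z
  have lim: "(\<lambda>N. S N z) \<longlonglongrightarrow> A z" for z
    unfolding A_def using Cauchy_convergent[OF Cauchy] by (simp add: convergent_LIMSEQ_iff)
  have norm: "norm (A z) \<le> c * M * norm z" for z
    by (rule Lim_bounded[OF tendsto_norm[OF lim]]) (use norm_S in auto)
  have "A (y + z) = A y + A z" for y z
    by (rule LIMSEQ_unique[OF lim])
      (use tendsto_add[OF lim[of y] lim[of z]] linear_add[OF bounded_linear.linear[OF linS]] in simp)
  moreover have "A (r *\<^sub>R z) = r *\<^sub>R A z" for r z
    by (rule LIMSEQ_unique[OF lim])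
      (use tendsto_scaleR[OF tendsto_const lim[of z], of r] linear_scale[OF bounded_linear.linear[OF linS]] in simp)
  ultimately have "bounded_linear A"
    by (rule bounded_linear_intro[where K = "c * M"]) (use norm in \<open>simp add: mult.commute\<close>)
  moreover have "(\<lambda>i. f i z *\<^sub>R e i) sums A z" for z
    using lim[of z] by (simp add: sums_def S_def)
  ultimately show ?thesis by (rule that[OF _ norm])
qed

end

text \<open>
  The right-hand side averages to the left-hand side over all signs. A good choice can be made one
  index at a time: the sign of a new index only enters in a linear cross term.
\<close>

lemma signs_quadratic_form:
  fixes b :: "'i \<Rightarrow> 'i \<Rightarrow> real"
  assumes "finite E"
  shows "\<exists>s\<in>E \<rightarrow>\<^sub>E {-1, 1}. (\<Sum>i\<in>E. b i i) \<le> (\<Sum>i\<in>E. \<Sum>j\<in>E. s i * s j * b i j)"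
  using assms
proof (induction E)
  case empty
  show ?case by simp
next
  case (insert x F)
  then obtain s where s: "s \<in> F \<rightarrow>\<^sub>E {-1, 1}"
    and le: "(\<Sum>i\<in>F. b i i) \<le> (\<Sum>i\<in>F. \<Sum>j\<in>F. s i * s j * b i j)"
    by blast
  define m where "m = (\<Sum>j\<in>F. s j * (b x j + b j x))"
  define t :: real where "t = (if m \<ge> 0 then 1 else -1)"
  define s' where "s' = s(x := t)"
  have s': "s' \<in> insert x F \<rightarrow>\<^sub>E {-1, 1}"
    unfolding s'_def using s by (intro PiE_fun_upd) (auto simp: t_def)
  have tm: "t * m \<ge> 0" by (simp add: t_def)
  have same: "s' j = s j" if "j \<in> F" for j using that insert.hyps by (auto simp: s'_def)
  have x: "s' x = t" by (simp add: s'_def)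
  have cross: "(\<Sum>j\<in>F. t * s j * b x j) + (\<Sum>i\<in>F. s i * t * b i x) = t * m"
    by (simp add: m_def sum_distrib_left algebra_simps sum.distrib)
  have "(\<Sum>i\<in>insert x F. \<Sum>j\<in>insert x F. s' i * s' j * b i j)
     = t * t * b x x + ((\<Sum>j\<in>F. t * s j * b x j) + (\<Sum>i\<in>F. s i * t * b i x))
       + (\<Sum>i\<in>F. \<Sum>j\<in>F. s i * s j * b i j)"
    using insert.hyps by (simp add: sum.distrib x same)
  then have "(\<Sum>i\<in>insert x F. \<Sum>j\<in>insert x F. s' i * s' j * b i j)
     = b x x + t * m + (\<Sum>i\<in>F. \<Sum>j\<in>F. s i * s j * b i j)"
    unfolding cross by (simp add: t_def)
  then show ?case using s' le tm insert.hyps by (intro bexI[of _ s']) auto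
qed

lemma signs_abs_quadratic_form:
  fixes b :: "'i \<Rightarrow> 'i \<Rightarrow> real"
  shows "\<exists>s\<in>E \<rightarrow>\<^sub>E {-1, 1}. \<bar>\<Sum>i\<in>E. b i i\<bar> \<le> \<bar>\<Sum>i\<in>E. \<Sum>j\<in>E. s i * s j * b i j\<bar>"
proof (cases "finite E")
  case False
  have "(\<lambda>i\<in>E. 1) \<in> E \<rightarrow>\<^sub>E {-1, 1::real}" by auto
  then show ?thesis using False by (intro bexI[of _ "\<lambda>i\<in>E. 1"]) auto
next
  case True
  obtain s where s: "s \<in> E \<rightarrow>\<^sub>E {-1, 1}"
    "(\<Sum>i\<in>E. b i i) \<le> (\<Sum>i\<in>E. \<Sum>j\<in>E. s i * s j * b i j)"
    using signs_quadratic_form[OF True, of b] by blast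
  obtain u where u: "u \<in> E \<rightarrow>\<^sub>E {-1, 1}"
    "- (\<Sum>i\<in>E. b i i) \<le> - (\<Sum>i\<in>E. \<Sum>j\<in>E. u i * u j * b i j)"
    using signs_quadratic_form[OF True, of "\<lambda>i j. - b i j"] by (auto simp: sum_negf)
  show ?thesis
  proof (cases "(\<Sum>i\<in>E. b i i) \<ge> 0")
    case True
    then show ?thesis using s by (intro bexI[of _ s]) linarith+
  next
    case False
    then show ?thesis using u by (intro bexI[of _ u]) linarith+
  qed
qed

section \<open>The components of the space of bounded sequences\<close>

lemma single_in_component [simp]: "single k x \<in> component k"
  by (simp add: component_def apply_single)

lemma component_eq_single: "z \<in> component k \<Longrightarrow> single k (apply_bcontfun z k) = z"
  by (rule bcontfun_eqI) (simp add: component_def apply_single)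

lemma apply_single_same [simp]: "apply_bcontfun (single k x) k = x"
  by (simp add: apply_single)

lemma norm_single [simp]: "norm (single k x) = norm x"
proof (rule antisym)
  show "norm (single k x) \<le> norm x" by (rule norm_bound) (simp add: apply_single)
  show "norm x \<le> norm (single k x)" using norm_bounded[of "single k x" k] by simp
qed

lemma linear_single: "linear (single k)"
  by (rule linearI; rule bcontfun_eqI) (simp_all add: apply_single)

lemma linear_apply: "linear (\<lambda>z :: 'a::banach linf. apply_bcontfun z k)"
  by (rule linearI) simp_all

lemmas single_simps = linear_add[OF linear_single] linear_diff[OF linear_single]
  linear_scale[OF linear_single] linear_0[OF linear_single]

lemma bounded_linear_single: "bounded_linear (single k)"
  by (rule bounded_linear_intro[where K = 1]) (simp_all add: single_simps)

lemma bounded_linear_apply: "bounded_linear (\<lambda>z :: 'a::banach linf. apply_bcontfun z k)"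
  by (rule bounded_linear_intro[where K = 1]) (simp_all add: norm_bounded)

lemma dist_single [simp]: "dist (single k x) (single k y) = dist x y"
  by (simp add: dist_norm flip: single_simps)

lemma component_closed [simp]:
  "y \<in> component k \<Longrightarrow> z \<in> component k \<Longrightarrow> y + z \<in> component k"
  "z \<in> component k \<Longrightarrow> c *\<^sub>R z \<in> component k"
  by (simp_all add: component_def)

text \<open>
  Extension by \<open>0\<close> off the component, in accordance with the representation of functionals in
  \<open>dual_on\<close>.
\<close>

definition lift_functional :: "nat \<Rightarrow> ('a::banach \<Rightarrow> real) \<Rightarrow> 'a linf \<Rightarrow> real" where
  "lift_functional k g = (\<lambda>z. if z \<in> component k then g (apply_bcontfun z k) else 0)"

lemma lift_functional_single [simp]: "lift_functional k g (single k x) = g x"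
  by (simp add: lift_functional_def)

lemma onorm_lift_functional: "onorm (lift_functional k g) = onorm g"
proof -
  have "range (\<lambda>z. norm (lift_functional k g z) / norm z) = range (\<lambda>x. norm (g x) / norm x)"
    (is "range ?l = range ?r")
  proof (intro equalityI image_subsetI)
    fix x show "?r x \<in> range ?l" by (rule range_eqI[of _ _ "single k x"]) simp
  next
    fix z
    show "?l z \<in> range ?r"
    proof (cases "z \<in> component k")
      case True
      then have "?l z = ?r (apply_bcontfun z k)"
        by (metis component_eq_single lift_functional_single norm_single)
      then show ?thesis by blast
    next
      case False
      then have "?l z = ?r 0" by (simp add: lift_functional_def)
      then show ?thesis by blast
    qed
  qed
  then show ?thesis by (simp add: onorm_def)
qed

lemma lift_functional_combine:
  "lift_functional k (\<lambda>x. 0) = (\<lambda>z. 0)"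
  "lift_functional k (\<lambda>x. f x + g x) = (\<lambda>z. lift_functional k f z + lift_functional k g z)"
  "lift_functional k (\<lambda>x. f x - g x) = (\<lambda>z. lift_functional k f z - lift_functional k g z)"
  "lift_functional k (\<lambda>x. c * f x) = (\<lambda>z. c * lift_functional k f z)"
  "lift_functional k (\<lambda>x. \<Sum>i\<in>I. a i * h i x) = (\<lambda>z. \<Sum>i\<in>I. a i * lift_functional k (h i) z)"
  by (simp_all add: lift_functional_def fun_eq_iff)

lemma lift_functional_of_dual:
  assumes "h \<in> dual_on (component k)"
  shows "lift_functional k (\<lambda>x. h (single k x)) = h"
  using assms by (auto simp: lift_functional_def dual_on_def fun_eq_iff component_eq_single)

lemma lift_functional_in_dual: "lift_functional k g \<in> dual_on (component k) \<longleftrightarrow> g \<in> dual_on UNIV"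
proof
  assume l: "lift_functional k g \<in> dual_on (component k)"
  then obtain B where B: "\<And>z. z \<in> component k \<Longrightarrow> \<bar>lift_functional k g z\<bar> \<le> B * norm z"
    unfolding dual_on_def by blast
  have "g (x + y) = g x + g y" for x y
  proof -
    have "lift_functional k g (single k x + single k y)
      = lift_functional k g (single k x) + lift_functional k g (single k y)"
      using l unfolding dual_on_def by simp
    then show ?thesis by (simp flip: single_simps)
  qed
  moreover have "g (c *\<^sub>R x) = c * g x" for c x
  proof -
    have "lift_functional k g (c *\<^sub>R single k x) = c * lift_functional k g (single k x)"
      using l unfolding dual_on_def by simp
    then show ?thesis by (simp flip: single_simps)
  qed
  moreover have "\<bar>g x\<bar> \<le> B * norm x" for x
    using B[of "single k x"] by simp
  ultimately show "g \<in> dual_on UNIV" unfolding dual_on_def by auto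
next
  assume g: "g \<in> dual_on UNIV"
  then obtain B where B: "\<And>x. \<bar>g x\<bar> \<le> B * norm x" unfolding dual_on_def by blast
  have "\<bar>lift_functional k g z\<bar> \<le> B * norm z" if "z \<in> component k" for z
    using B[of "apply_bcontfun z k"] that
    by (metis component_eq_single lift_functional_single norm_single)
  then show "lift_functional k g \<in> dual_on (component k)"
    using g unfolding dual_on_def by (auto simp: lift_functional_def)
qed

lemma sums_array_iff:
  "(\<lambda>j. a j *\<^sub>R array e k j) sums single k x \<longleftrightarrow> (\<lambda>j. a j *\<^sub>R e j) sums x"
proof -
  have "(\<Sum>j<n. a j *\<^sub>R array e k j) = single k (\<Sum>j<n. a j *\<^sub>R e j)" for n
    by (simp add: array_def linear_sum[OF linear_single] single_simps)
  then show ?thesis by (simp add: sums_def lim_sequentially)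
qed

lemma normalized_schauder_basis_array:
  assumes "normalized_schauder_basis UNIV e"
  shows "normalized_schauder_basis (component k) (array e k)"
  unfolding normalized_schauder_basis_def
proof (intro conjI allI ballI)
  fix z :: "'a linf" assume "z \<in> component k"
  then have z: "z = single k (apply_bcontfun z k)" by (simp add: component_eq_single)
  show "\<exists>!a. (\<lambda>j. a j *\<^sub>R array e k j) sums z"
    using assms by (subst z) (simp add: sums_array_iff normalized_schauder_basis_def)
qed (use assms in \<open>simp_all add: array_def normalized_schauder_basis_def\<close>)

lemma coord_array: "coord (component k) (array e k) j = lift_functional k (coord UNIV e j)"
proof
  fix z
  show "coord (component k) (array e k) j z = lift_functional k (coord UNIV e j) z"
  proof (cases "z \<in> component k")
    case True
    then have "coord (component k) (array e k) j (single k (apply_bcontfun z k))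
        = coord UNIV e j (apply_bcontfun z k)"
      by (simp add: coord_def sums_array_iff)
    with True show ?thesis by (simp add: component_eq_single lift_functional_def)
  qed (simp add: coord_def lift_functional_def)
qed

lemma block_vector_array: "block_vector (array e k) r s = single k (block_vector e r s)"
  by (simp add: block_vector_def array_def linear_sum[OF linear_single] single_simps)

lemma block_functional_array:
  "block_functional (component k) (array e k) r s = lift_functional k (block_functional UNIV e r s)"
  by (simp add: block_functional_def[abs_def] coord_array lift_functional_combine)

lemma comb_norm_single: "comb_norm (\<lambda>n. single k (x n)) = comb_norm x"
proof
  fix a
  have "(\<Sum>i | a i \<noteq> 0. a i *\<^sub>R single k (x i)) = single k (\<Sum>i | a i \<noteq> 0. a i *\<^sub>R x i)"
    by (simp add: linear_sum[OF linear_single] single_simps)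
  then show "comb_norm (\<lambda>n. single k (x n)) a = comb_norm x a" by (simp add: comb_norm_def)
qed

lemma dual_comb_norm_lift: "dual_comb_norm (\<lambda>n. lift_functional k (f n)) = dual_comb_norm f"
  by (simp add: dual_comb_norm_def[abs_def] onorm_lift_functional flip: lift_functional_combine)

lemma comb_norm_array: "comb_norm (array e k) = comb_norm e"
  using comb_norm_single[of k e] by (simp add: array_def[abs_def])

lemma dual_comb_norm_array:
  "dual_comb_norm (coord (component k) (array e k)) = dual_comb_norm (coord UNIV e)"
  using dual_comb_norm_lift[of k "coord UNIV e"] by (simp add: coord_array[abs_def])

lemma infdist_single:
  assumes "W \<subseteq> component k"
  shows "infdist (single k x) W = infdist x (single k -` W)"
proof -
  have W: "W = single k ` (single k -` W)"
  proof (intro equalityI subsetI)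
    fix z assume "z \<in> W"
    then show "z \<in> single k ` (single k -` W)"
      using component_eq_single[of z k] assms by (metis image_eqI subsetD vimageI)
  qed auto
  have "infdist (single k x) (single k ` V) = infdist x V" for V
    by (simp add: infdist_def image_image)
  then show ?thesis by (subst W)
qed

lemma dual_infdist_lift:
  assumes "G \<subseteq> dual_on (component k)"
  shows "dual_infdist (lift_functional k f) G = dual_infdist f {g. lift_functional k g \<in> G}"
proof -
  have G: "G = lift_functional k ` {g. lift_functional k g \<in> G}"
  proof (intro equalityI subsetI)
    fix h assume "h \<in> G"
    then show "h \<in> lift_functional k ` {g. lift_functional k g \<in> G}"
      using lift_functional_of_dual[of h k] assms by (metis (mono_tags) image_eqI mem_Collect_eq subsetD)
  qed auto
  have "dual_infdist (lift_functional k f) (lift_functional k ` {g. lift_functional k g \<in> G})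
      = dual_infdist f {g. lift_functional k g \<in> G}"
    by (simp add: dual_infdist_def image_image onorm_lift_functional flip: lift_functional_combine)
  then show ?thesis by (simp flip: G)
qed

lemma cof_component:
  assumes "W \<in> cof (component k)"
  shows "single k -` W \<in> cof UNIV"
proof -
  obtain F where W: "W \<subseteq> component k" "subspace W"
    and F: "finite F" "F \<subseteq> component k" "component k \<subseteq> span (W \<union> F)"
    using assms unfolding cof_def by blast
  let ?ev = "\<lambda>z :: 'a linf. apply_bcontfun z k"
  have ev: "?ev ` V = single k -` V" if "V \<subseteq> component k" for V
    using that by (force simp: component_eq_single image_iff)
  have "x \<in> span (single k -` W \<union> ?ev ` F)" for x
  proof -
    have "?ev (single k x) \<in> ?ev ` span (W \<union> F)" using F(3) single_in_component by blast
    also have "\<dots> = span (?ev ` (W \<union> F))" by (rule linear_span_image[OF linear_apply, symmetric])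
    also have "?ev ` (W \<union> F) = single k -` W \<union> ?ev ` F" by (simp add: image_Un ev[OF W(1)])
    finally show ?thesis by simp
  qed
  moreover have "subspace (single k -` W)"
    using W(2) by (rule linear_subspace_vimage[OF linear_single])
  ultimately show ?thesis unfolding cof_def using F(1) by blast
qed

text \<open>
  Functionals on the component and on \<open>X\<close> correspond to each other via \<open>single k\<close>. The preimage of \<open>G\<close> is
  \<open>w\<^sup>*\<close>-closed because each evaluation of a lifted functional is \<open>0\<close> or an evaluation of the functional.
\<close>

lemma cof_wstar_component:
  assumes "G \<in> cof_wstar (component k)"
  shows "{g. lift_functional k g \<in> G} \<in> cof_wstar UNIV"
proof -
  let ?l = "lift_functional k :: ('a \<Rightarrow> real) \<Rightarrow> _"
  let ?r = "\<lambda>h x. h (single k x)"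
  obtain F where G: "G \<subseteq> dual_on (component k)" "(\<lambda>x. 0) \<in> G"
      "\<And>f g. f \<in> G \<Longrightarrow> g \<in> G \<Longrightarrow> (\<lambda>x. f x + g x) \<in> G"
      "\<And>c f. f \<in> G \<Longrightarrow> (\<lambda>x. c * f x) \<in> G"
      "closedin (top_of_set (dual_on (component k))) G"
    and F: "finite F" "F \<subseteq> dual_on (component k)"
      "\<And>f. f \<in> dual_on (component k) \<Longrightarrow> \<exists>g\<in>G. \<exists>c. f = (\<lambda>x. g x + (\<Sum>h\<in>F. c h * h x))"
    using assms unfolding cof_wstar_def by blast
  have "{g. ?l g \<in> G} \<subseteq> dual_on UNIV"
    using G(1) lift_functional_in_dual by blast
  moreover have "finite (?r ` F)" "?r ` F \<subseteq> dual_on UNIV"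
  proof -
    show "?r ` F \<subseteq> dual_on UNIV"
    proof (rule image_subsetI)
      fix h assume "h \<in> F"
      then have h: "h \<in> dual_on (component k)" using F(2) by blast
      then have "?l (?r h) \<in> dual_on (component k)" by (simp add: lift_functional_of_dual)
      then show "?r h \<in> dual_on UNIV" by (simp only: lift_functional_in_dual)
    qed
  qed (use F(1) in simp)
  moreover have "\<exists>g\<in>{g. ?l g \<in> G}. \<exists>c. f = (\<lambda>x. g x + (\<Sum>h\<in>?r ` F. c h * h x))"
    if f: "f \<in> dual_on UNIV" for f
  proof -
    obtain g c where g: "g \<in> G" and eq: "?l f = (\<lambda>z. g z + (\<Sum>h\<in>F. c h * h z))"
      using F(3)[of "?l f"] f lift_functional_in_dual by blast
    have inj: "inj_on ?r F"
      by (rule inj_on_inverseI[of _ ?l]) (use F(2) lift_functional_of_dual in blast)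
    have "f x = ?r g x + (\<Sum>h\<in>?r ` F. c (?l h) * h x)" for x
    proof -
      have "(\<Sum>h\<in>?r ` F. c (?l h) * h x) = (\<Sum>h\<in>F. c (?l (?r h)) * ?r h x)"
        by (subst sum.reindex[OF inj]) simp
      also have "\<dots> = (\<Sum>h\<in>F. c h * h (single k x))"
      proof (rule sum.cong[OF refl])
        fix h assume "h \<in> F"
        then have "?l (?r h) = h" using F(2) lift_functional_of_dual by blast
        then show "c (?l (?r h)) * ?r h x = c h * h (single k x)" by simp
      qed
      finally show ?thesis using fun_cong[OF eq, of "single k x"] by simp
    qed
    moreover have "?l (?r g) \<in> G" using g G(1) lift_functional_of_dual by (metis subsetD)
    ultimately show ?thesis by (intro bexI[of _ "?r g"] exI[of _ "\<lambda>h. c (?l h)"]) auto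
  qed
  moreover have "closedin (top_of_set (dual_on UNIV)) {g. ?l g \<in> G}"
  proof -
    have cont: "continuous_on (dual_on UNIV) ?l"
    proof (rule continuous_on_coordinatewise_then_product)
      fix z
      have "continuous_on (dual_on UNIV) (\<lambda>g :: 'a \<Rightarrow> real. g (apply_bcontfun z k))"
        by (rule continuous_on_subset[OF continuous_on_product_coordinates]) simp
      then show "continuous_on (dual_on UNIV) (\<lambda>g. ?l g z)"
        by (cases "z \<in> component k") (simp_all add: lift_functional_def)
    qed
    have "closedin (top_of_set (dual_on UNIV)) (dual_on UNIV \<inter> ?l -` G)"
      by (rule continuous_closedin_preimage_gen[OF cont _ G(5)])
        (use lift_functional_in_dual in blast)
    moreover have "dual_on UNIV \<inter> ?l -` G = {g. ?l g \<in> G}"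
      using G(1) lift_functional_in_dual by blast
    ultimately show ?thesis by simp
  qed
  ultimately show ?thesis
    unfolding cof_wstar_def using G(2,3,4)
    by (auto simp: lift_functional_combine intro!: exI[of _ "?r ` F"])
qed

definition pull_challenge :: "nat \<Rightarrow> 'a::banach linf challenge \<Rightarrow> 'a challenge" where
  "pull_challenge k c =
     Challenge (tol c) (single k -` space_part c) {g. lift_functional k g \<in> dual_part c}"

lemma pull_challenge_sel [simp]:
  "tol (pull_challenge k c) = tol c"
  "space_part (pull_challenge k c) = single k -` space_part c"
  "dual_part (pull_challenge k c) = {g. lift_functional k g \<in> dual_part c}"
  by (simp_all add: pull_challenge_def)

lemma legal_pull_challenge:
  "legal_challenge (component k) c \<Longrightarrow> legal_challenge UNIV (pull_challenge k c)"
  by (simp add: legal_challenge_def cof_component cof_wstar_component)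

text \<open>
  Player II translates each challenge to \<open>X\<close> and answers with the winning strategy there. All quantities
  in the winning condition agree because \<open>single k\<close> is an isometry onto the component.
\<close>

lemma winning_strategy_component:
  assumes win: "winning_strategy UNIV e C \<eta> \<sigma>"
  shows "winning_strategy (component k) (array e k) C \<eta> (\<lambda>P chs. \<sigma> P (map (pull_challenge k) chs))"
    (is "winning_strategy _ _ _ _ ?\<sigma>")
  unfolding winning_strategy_def
proof (intro allI impI)
  fix N\<^sub>1 N\<^sub>2 :: "nat set" and ch :: "nat \<Rightarrow> 'a linf challenge" and sg :: "nat \<Rightarrow> nat \<Rightarrow> real"
  assume asm: "N\<^sub>1 \<union> N\<^sub>2 = UNIV \<and> N\<^sub>1 \<inter> N\<^sub>2 = {} \<and> (\<forall>n. legal_challenge (component k) (ch n)) \<and>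
    (\<forall>n. sg n \<in> supp (reply ?\<sigma> (N\<^sub>1, N\<^sub>2) ch sg n) \<rightarrow>\<^sub>E {-1, 1})"
  have reply: "reply ?\<sigma> (N\<^sub>1, N\<^sub>2) ch sg n = reply \<sigma> (N\<^sub>1, N\<^sub>2) (\<lambda>n. pull_challenge k (ch n)) sg n"
    for n
    by (simp add: reply_def comp_def)
  have legal: "space_part (ch n) \<subseteq> component k" "dual_part (ch n) \<subseteq> dual_on (component k)" for n
    using asm by (auto simp: legal_challenge_def cof_def cof_wstar_def)
  define r where "r = reply \<sigma> (N\<^sub>1, N\<^sub>2) (\<lambda>n. pull_challenge k (ch n)) sg"
  have "\<forall>n. legal_challenge UNIV (pull_challenge k (ch n))"
    using asm legal_pull_challenge by blast
  then have "(\<forall>n. legal_response \<eta> (N\<^sub>1, N\<^sub>2) (r n)) \<and>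
    impartially_equivalent (C + \<eta>) (comb_norm (\<lambda>n. block_vector e (r n) (sg n))) (comb_norm e) \<and>
    impartially_equivalent (C + \<eta>) (dual_comb_norm (\<lambda>n. block_functional UNIV e (r n) (sg n)))
      (dual_comb_norm (coord UNIV e)) \<and>
    (\<forall>n. infdist (block_vector e (r n) (sg n)) (space_part (pull_challenge k (ch n)))
        < tol (pull_challenge k (ch n))) \<and>
    (\<forall>n. dual_infdist (block_functional UNIV e (r n) (sg n)) (dual_part (pull_challenge k (ch n)))
        < tol (pull_challenge k (ch n)))"
    using win[unfolded winning_strategy_def, rule_format, of N\<^sub>1 N\<^sub>2 "\<lambda>n. pull_challenge k (ch n)" sg]
      asm by (simp add: Let_def reply r_def)
  then show "let r = reply ?\<sigma> (N\<^sub>1, N\<^sub>2) ch sg;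
        x = \<lambda>n. block_vector (array e k) (r n) (sg n);
        x' = \<lambda>n. block_functional (component k) (array e k) (r n) (sg n)
    in (\<forall>n. legal_response \<eta> (N\<^sub>1, N\<^sub>2) (r n)) \<and>
       impartially_equivalent (C + \<eta>) (comb_norm x) (comb_norm (array e k)) \<and>
       impartially_equivalent (C + \<eta>) (dual_comb_norm x')
         (dual_comb_norm (coord (component k) (array e k))) \<and>
       (\<forall>n. infdist (x n) (space_part (ch n)) < tol (ch n)) \<and>
       (\<forall>n. dual_infdist (x' n) (dual_part (ch n)) < tol (ch n))"
    by (simp add: Let_def reply block_vector_array block_functional_array comb_norm_single
        dual_comb_norm_lift infdist_single[OF legal(1)] dual_infdist_lift[OF legal(2)]
        comb_norm_array dual_comb_norm_array flip: r_def)
qed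

theorem strategically_reproducible_component:
  assumes "strategically_reproducible C UNIV e"
  shows "strategically_reproducible C (component k) (array e k)"
  using assms winning_strategy_component normalized_schauder_basis_array
  unfolding strategically_reproducible_def by metis

section \<open>Operators on the space of bounded sequences\<close>

lemma bounded_in_bcontfun:
  fixes f :: "nat \<Rightarrow> 'a::banach"
  assumes "\<And>i. norm (f i) \<le> c"
  shows "f \<in> bcontfun"
  using assms by (auto simp: bcontfun_def bounded_iff)

lemma linf_operator:
  fixes F :: "'b::real_normed_vector \<Rightarrow> nat \<Rightarrow> 'a::banach"
  assumes add: "\<And>y z k. F (y + z) k = F y k + F z k"
    and scale: "\<And>c z k. F (c *\<^sub>R z) k = c *\<^sub>R F z k"
    and bound: "\<And>z k. norm (F z k) \<le> M * norm z"
    and M: "0 \<le> M"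
  obtains L :: "'b \<Rightarrow>\<^sub>L 'a linf" where "\<And>z k. apply_bcontfun (L z) k = F z k" "norm L \<le> M"
proof -
  have app: "apply_bcontfun (Bcontfun (F z)) k = F z k" for z k
    by (simp add: Bcontfun_inverse bounded_in_bcontfun[OF bound])
  have norm: "norm (Bcontfun (F z)) \<le> M * norm z" for z
    by (rule norm_bound) (simp add: app bound)
  have "bounded_linear (\<lambda>z. Bcontfun (F z))"
    by (rule bounded_linear_intro[where K = M]; (rule bcontfun_eqI)?)
      (simp_all add: app add scale norm mult.commute)
  then have eq: "blinfun_apply (Blinfun (\<lambda>z. Bcontfun (F z))) z = Bcontfun (F z)" for z
    by (simp add: bounded_linear_Blinfun_apply)
  show ?thesis
  proof (rule that)
    show "apply_bcontfun (Blinfun (\<lambda>z. Bcontfun (F z)) z) k = F z k" for z k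
      by (simp add: eq app)
    show "norm (Blinfun (\<lambda>z. Bcontfun (F z))) \<le> M"
      by (rule norm_blinfun_bound[OF M]) (simp add: eq norm)
  qed
qed

text \<open>
  The Neumann series \<open>\<Sum>\<^sub>n (-R)\<^sup>n\<close>, summed in each coordinate, so that only the completeness of \<open>X\<close> is
  used. Splitting off its first term shows \<open>S z = z + S (- R z)\<close>, that is, a left inverse; this is
  the side that a factorization of the identity calls for.
\<close>

lemma left_inverse_near_identity:
  fixes R :: "'a::banach linf \<Rightarrow>\<^sub>L 'a linf"
  assumes R: "norm R < 1"
  obtains S where "S o\<^sub>L (id_blinfun + R) = id_blinfun"
proof -
  define V where "V n z = (blinfun_apply (- R) ^^ n) z" for n z
  have V0: "V 0 z = z" and VS: "V (Suc n) z = V n (- R z)" for n z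
    unfolding V_def funpow_Suc_right by (simp_all add: uminus_blinfun.rep_eq)
  have VS': "V (Suc n) z = - R (V n z)" for n z
    by (simp add: V_def uminus_blinfun.rep_eq)
  have V_add: "V n (y + z) = V n y + V n z" for n y z
    by (induction n) (simp_all add: V0 VS' blinfun.add_right)
  have V_scale: "V n (c *\<^sub>R z) = c *\<^sub>R V n z" for n c z
    by (induction n) (simp_all add: V0 VS' blinfun.scaleR_right)
  have V_norm: "norm (V n z) \<le> norm R ^ n * norm z" for n z
  proof (induction n)
    case (Suc n)
    have "norm (V (Suc n) z) \<le> norm R * norm (V n z)" by (simp add: VS' norm_blinfun)
    also have "\<dots> \<le> norm R * (norm R ^ n * norm z)" by (rule mult_left_mono[OF Suc]) simp
    finally show ?case by simp
  qed (simp add: V0)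
  have V_norm': "norm (apply_bcontfun (V n z) k) \<le> norm R ^ n * norm z" for n z k
    by (rule order_trans[OF norm_bounded V_norm])
  have geom: "summable (\<lambda>n. norm R ^ n * norm z)" for z
    using R by (intro summable_mult2 summable_geometric) simp
  have abs: "summable (\<lambda>n. norm (apply_bcontfun (V n z) k))" for z k
    by (rule summable_comparison_test'[OF geom[of z], of 0]) (simp add: V_norm')
  have summ: "summable (\<lambda>n. apply_bcontfun (V n z) k)" for z k
    by (rule summable_norm_cancel[OF abs])
  define F where "F z k = (\<Sum>n. apply_bcontfun (V n z) k)" for z k
  have F_norm: "norm (F z k) \<le> (1 / (1 - norm R)) * norm z" for z k
  proof -
    have "norm (F z k) \<le> (\<Sum>n. norm (apply_bcontfun (V n z) k))"
      unfolding F_def by (rule summable_norm[OF abs])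
    also have "\<dots> \<le> (\<Sum>n. norm R ^ n * norm z)" by (rule suminf_le[OF V_norm' abs geom])
    also have "\<dots> = (1 / (1 - norm R)) * norm z"
      using R suminf_mult2[OF summable_geometric[of "norm R"], of "norm z"]
      by (simp add: suminf_geometric)
    finally show ?thesis .
  qed
  have F_add: "F (y + z) k = F y k + F z k" for y z k
    unfolding F_def V_add by (simp add: suminf_add[OF summ summ])
  have F_scale: "F (c *\<^sub>R z) k = c *\<^sub>R F z k" for c z k
    unfolding F_def V_scale by (simp add: suminf_scaleR_right[OF summ])
  have nn: "0 \<le> 1 / (1 - norm R)" using R by simp
  obtain S :: "'a linf \<Rightarrow>\<^sub>L 'a linf" where S: "\<And>z k. apply_bcontfun (S z) k = F z k"
    by (rule linf_operator[OF F_add F_scale F_norm nn]) (rule that)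
  have "S (z + R z) = z" for z
  proof (rule bcontfun_eqI)
    fix k
    have "F z k = apply_bcontfun z k + F (- R z) k"
      using suminf_split_head[OF summ[of z k]] by (simp add: F_def V0 VS)
    then have "apply_bcontfun (S z - S (- R z)) k = apply_bcontfun z k" by (simp add: S)
    then show "apply_bcontfun (S (z + R z)) k = apply_bcontfun z k"
      by (simp add: blinfun.add_right blinfun.minus_right)
  qed
  then have "S o\<^sub>L (id_blinfun + R) = id_blinfun"
    by (intro blinfun_eqI) (simp add: blinfun.add_left)
  then show ?thesis by (rule that)
qed

section \<open>Discarding the singular part of countably many functionals\<close>

definition restrict_linf :: "nat set \<Rightarrow> 'a::banach linf \<Rightarrow> 'a linf" where
  "restrict_linf I z = Bcontfun (\<lambda>i. if i \<in> I then apply_bcontfun z i else 0)"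

lemma apply_restrict_linf:
  "apply_bcontfun (restrict_linf I z) i = (if i \<in> I then apply_bcontfun z i else 0)"
proof -
  have "(\<lambda>i. if i \<in> I then apply_bcontfun z i else 0) \<in> bcontfun"
    by (rule bounded_in_bcontfun[where c = "norm z"]) (simp add: norm_bounded)
  then show ?thesis by (simp add: restrict_linf_def Bcontfun_inverse)
qed

lemma uncountable_nat_bool: "uncountable (UNIV :: (nat \<Rightarrow> bool) set)"
proof
  assume "countable (UNIV :: (nat \<Rightarrow> bool) set)"
  then have "range (from_nat_into (UNIV :: (nat \<Rightarrow> bool) set)) = UNIV" by simp
  then obtain f :: "nat \<Rightarrow> nat \<Rightarrow> bool" where "range f = UNIV" by blast
  then obtain n where "f n = (\<lambda>i. \<not> f i i)" by (metis rangeE UNIV_I)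
  then have "f n n = (\<not> f n n)" by (rule fun_cong)
  then show False by blast
qed

text \<open>
  Each branch of the infinite binary tree is the set of its (encoded) initial segments; two
  different branches share only the segments before they split.
\<close>

lemma almost_disjoint_family:
  obtains A :: "(nat \<Rightarrow> bool) \<Rightarrow> nat set"
  where "\<And>f. infinite (A f)" "\<And>f g. f \<noteq> g \<Longrightarrow> finite (A f \<inter> A g)"
proof -
  define A :: "(nat \<Rightarrow> bool) \<Rightarrow> nat set" where "A f = range (\<lambda>n. to_nat (map f [0..<n]))" for f
  have "infinite (A f)" for f
  proof -
    have "inj (\<lambda>n. to_nat (map f [0..<n]))"
      by (rule injI) (metis inj_eq[OF inj_to_nat] length_map length_upt diff_zero)
    then show ?thesis unfolding A_def by (rule range_inj_infinite)
  qed
  moreover have "finite (A f \<inter> A g)" if "f \<noteq> g" for f g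
  proof -
    have "\<exists>x. f x \<noteq> g x" using that by (auto simp: fun_eq_iff)
    then obtain x where x: "f x \<noteq> g x" by blast
    have "A f \<inter> A g \<subseteq> (\<lambda>n. to_nat (map f [0..<n])) ` {..x}"
    proof
      fix y assume "y \<in> A f \<inter> A g"
      then obtain n m where n: "y = to_nat (map f [0..<n])" and m: "y = to_nat (map g [0..<m])"
        unfolding A_def by blast
      then have eq: "map f [0..<n] = map g [0..<m]" by simp
      then have "n = m" by (metis length_map length_upt diff_zero)
      with eq have "\<not> x < n" using x by auto
      then show "y \<in> (\<lambda>n. to_nat (map f [0..<n])) ` {..x}" using n by auto
    qed
    then show ?thesis using finite_surj by blast
  qed
  ultimately show ?thesis by (rule that)
qed

text \<open>
  A functional can be singular on few almost disjoint sets only. The tails of \<open>p\<close> witnesses beyond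
  a common index have disjoint supports, so their signed sum has norm at most 1, but the
  functional exceeds \<open>p r\<close> there.
\<close>

lemma finitely_many_singular:
  fixes \<phi> :: "'a::banach linf \<Rightarrow> real" and A :: "'i \<Rightarrow> nat set"
  assumes \<phi>: "bounded_linear \<phi>" and r: "0 < r"
    and disj: "\<And>a b. a \<noteq> b \<Longrightarrow> finite (A a \<inter> A b)"
  shows "finite {a. \<exists>z. norm z \<le> 1 \<and> (\<forall>i. i \<notin> A a \<longrightarrow> apply_bcontfun z i = 0) \<and>
    (\<forall>n. \<exists>N\<ge>n. r < \<bar>\<phi> (restrict_linf {N..} z)\<bar>)}" (is "finite ?Bad")
proof (rule ccontr)
  assume inf: "infinite ?Bad"
  obtain K where K: "\<And>z. norm (\<phi> z) \<le> norm z * K" and K0: "0 \<le> K"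
    using bounded_linear.nonneg_bounded[OF \<phi>] by blast
  obtain p :: nat where p: "K / r < p" using reals_Archimedean2 by blast
  obtain D where D: "D \<subseteq> ?Bad" "finite D" "card D = p"
    using infinite_arbitrarily_large[OF inf] by blast
  have "finite (\<Union>a\<in>D. \<Union>b\<in>D - {a}. A a \<inter> A b)"
    using D(2) disj by (intro finite_UN_I) auto
  \<comment> \<open>beyond \<open>n\<close> the sets \<open>A a\<close> for \<open>a \<in> D\<close> are disjoint\<close>
  from finite_nat_bounded[OF this] obtain n
    where n: "(\<Union>a\<in>D. \<Union>b\<in>D - {a}. A a \<inter> A b) \<subseteq> {..<n}"
    by (elim exE)
  have "\<forall>a\<in>D. \<exists>p. norm (fst p) \<le> 1 \<and> (\<forall>i. i \<notin> A a \<longrightarrow> apply_bcontfun (fst p) i = 0) \<and>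
      n \<le> snd p \<and> r < \<bar>\<phi> (restrict_linf {snd p..} (fst p))\<bar>"
    using D(1) by fastforce
  from bchoice[OF this] obtain g where
    g: "\<forall>a\<in>D. norm (fst (g a)) \<le> 1 \<and> (\<forall>i. i \<notin> A a \<longrightarrow> apply_bcontfun (fst (g a)) i = 0) \<and>
      n \<le> snd (g a) \<and> r < \<bar>\<phi> (restrict_linf {snd (g a)..} (fst (g a)))\<bar>"
    by blast
  define z where "z a = fst (g a)" for a
  define N where "N a = snd (g a)" for a
  have z: "norm (z a) \<le> 1" "i \<notin> A a \<Longrightarrow> apply_bcontfun (z a) i = 0"
    and N: "n \<le> N a" "r < \<bar>\<phi> (restrict_linf {N a..} (z a))\<bar>" if "a \<in> D" for a i
    using g that by (auto simp: z_def N_def)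
  define t where "t a = restrict_linf {N a..} (z a)" for a
  define w where "w = (\<Sum>a\<in>D. sgn (\<phi> (t a)) *\<^sub>R t a)"
  have app_sum: "apply_bcontfun (\<Sum>a\<in>D. f a) i = (\<Sum>a\<in>D. apply_bcontfun (f a) i)" 
    for f :: "'i \<Rightarrow> 'a linf" and i
    by (rule linear_sum[OF linear_apply])
  have "norm (apply_bcontfun w i) \<le> 1" for i
  proof (cases "\<exists>a\<in>D. apply_bcontfun (t a) i \<noteq> 0")
    case False
    then show ?thesis by (simp add: w_def app_sum)
  next
    case True
    then obtain a where a: "a \<in> D" "apply_bcontfun (t a) i \<noteq> 0" by blast
    have zero: "apply_bcontfun (t b) i = 0" if "b \<in> D - {a}" for b
    proof (rule ccontr)
      assume b: "apply_bcontfun (t b) i \<noteq> 0"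
      then have "i \<ge> N a" "i \<in> A a" "i \<in> A b"
        using a z(2) that by (auto simp: t_def apply_restrict_linf split: if_splits)
      then have "i \<in> (\<Union>a\<in>D. \<Union>b\<in>D - {a}. A a \<inter> A b)" using a(1) that by blast
      then have "i < n" using n by blast
      then show False using N(1)[OF a(1)] \<open>i \<ge> N a\<close> by linarith
    qed
    have "apply_bcontfun w i = sgn (\<phi> (t a)) *\<^sub>R apply_bcontfun (t a) i
        + (\<Sum>b\<in>D - {a}. sgn (\<phi> (t b)) *\<^sub>R apply_bcontfun (t b) i)"
      unfolding w_def app_sum using D(2) a(1) by (subst sum.remove[of D a]) auto
    also have "\<dots> = sgn (\<phi> (t a)) *\<^sub>R apply_bcontfun (t a) i" using zero by simp
    also have "norm \<dots> \<le> norm (apply_bcontfun (t a) i)"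
      by (simp add: abs_sgn_eq)
    also have "\<dots> \<le> norm (apply_bcontfun (z a) i)" by (simp add: t_def apply_restrict_linf)
    also have "\<dots> \<le> 1" using norm_bounded[of "z a" i] z(1)[OF a(1)] by linarith
    finally show ?thesis .
  qed
  then have w1: "norm w \<le> 1" by (rule norm_bound)
  have "\<phi> w = (\<Sum>a\<in>D. \<bar>\<phi> (t a)\<bar>)"
    unfolding w_def using bounded_linear.linear[OF \<phi>]
    by (simp add: linear_sum linear_scale mult.commute[of "sgn _"] abs_sgn)
  moreover have "card D * r \<le> (\<Sum>a\<in>D. \<bar>\<phi> (t a)\<bar>)"
    using sum_bounded_below[of D r "\<lambda>a. \<bar>\<phi> (t a)\<bar>"] N(2) by (simp add: t_def less_imp_le)
  moreover have "\<phi> w \<le> K"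
    using K[of w] mult_right_mono[OF w1 K0] by simp
  ultimately have "real (card D) * r \<le> K" by linarith
  then have "p * r \<le> K" using D(3) by simp
  then show False using p r by (simp add: field_simps)
qed

text \<open>
  Countably many functionals and tolerances rule out only countably many of the
  uncountably many sets of an almost disjoint family.
\<close>

lemma singular_free_subset:
  fixes \<phi> :: "nat \<Rightarrow> 'a::banach linf \<Rightarrow> real"
  assumes \<phi>: "\<And>n. bounded_linear (\<phi> n)"
  obtains I where "infinite I"
    "\<And>n. \<forall>z. (\<forall>i. i \<notin> I \<longrightarrow> apply_bcontfun z i = 0) \<longrightarrow> (\<lambda>N. \<phi> n (restrict_linf {N..} z)) \<longlonglongrightarrow> 0"
proof -
  obtain A :: "(nat \<Rightarrow> bool) \<Rightarrow> nat set"
    where inf: "\<And>f. infinite (A f)" and disj: "\<And>f g. f \<noteq> g \<Longrightarrow> finite (A f \<inter> A g)"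
    by (rule almost_disjoint_family) (rule that)
  define Bad where "Bad n m = {a. \<exists>z. norm z \<le> 1 \<and> (\<forall>i. i \<notin> A a \<longrightarrow> apply_bcontfun z i = 0) \<and>
    (\<forall>k. \<exists>N\<ge>k. inverse (real (Suc m)) < \<bar>\<phi> n (restrict_linf {N..} z)\<bar>)}" for n m
  have fin: "finite (Bad n m)" for n m
    unfolding Bad_def by (rule finitely_many_singular[OF \<phi> _ disj]) simp_all
  have "countable (\<Union>n m. Bad n m)"
    by (intro countable_UN countable_finite[OF fin]) simp_all
  then have "(\<Union>n m. Bad n m) \<noteq> UNIV" using uncountable_nat_bool by metis
  then obtain a where "a \<notin> (\<Union>n m. Bad n m)" by (metis UNIV_eq_I)
  then have a: "a \<notin> Bad n m" for n m by simp
  show ?thesis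
  proof (rule that[OF inf[of a]], intro allI impI)
    fix n and z :: "'a linf" assume z: "\<forall>i. i \<notin> A a \<longrightarrow> apply_bcontfun z i = 0"
    define c where "c = norm z + 1"
    have c: "0 < c" by (simp add: c_def add_nonneg_pos)
    define y where "y = (1 / c) *\<^sub>R z"
    have "norm y \<le> 1" using c by (simp add: y_def c_def)
    moreover have "\<forall>i. i \<notin> A a \<longrightarrow> apply_bcontfun y i = 0" using z by (simp add: y_def)
    ultimately have small: "\<exists>k. \<forall>N\<ge>k. \<bar>\<phi> n (restrict_linf {N..} y)\<bar> \<le> inverse (real (Suc m))" for m
      using a[of n m] unfolding Bad_def by (simp add: not_less) (meson not_less)
    have zy: "restrict_linf J z = c *\<^sub>R restrict_linf J y" for J
      using c by (intro bcontfun_eqI) (simp add: apply_restrict_linf y_def)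
    show "(\<lambda>N. \<phi> n (restrict_linf {N..} z)) \<longlonglongrightarrow> 0"
    proof (rule LIMSEQ_I)
      fix r :: real assume r: "0 < r"
      then have "0 < r / c" using c by simp
      then obtain m where m: "inverse (real (Suc m)) < r / c" using reals_Archimedean by blast
      obtain k where k: "\<And>N. N \<ge> k \<Longrightarrow> \<bar>\<phi> n (restrict_linf {N..} y)\<bar> \<le> inverse (real (Suc m))"
        using small by blast
      have "norm (\<phi> n (restrict_linf {N..} z) - 0) < r" if "N \<ge> k" for N
      proof -
        have "norm (\<phi> n (restrict_linf {N..} z) - 0) = c * \<bar>\<phi> n (restrict_linf {N..} y)\<bar>"
          using c by (simp add: zy linear_scale[OF bounded_linear.linear[OF \<phi>]] abs_mult)
        also have "\<bar>\<phi> n (restrict_linf {N..} y)\<bar> < r / c" using k[OF that] m by linarith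
        finally show ?thesis using c by (simp add: field_simps)
      qed
      then show "\<exists>k. \<forall>N\<ge>k. norm (\<phi> n (restrict_linf {N..} z) - 0) < r" by blast
    qed
  qed
qed

text \<open>
  Order continuity: the value of a functional at a bounded sequence is the limit of its values at
  the initial segments of the sequence.
\<close>

definition tail_null :: "('a::banach linf \<Rightarrow> real) \<Rightarrow> bool" where
  "tail_null \<phi> \<longleftrightarrow> (\<forall>z. (\<lambda>N. \<phi> (restrict_linf {N..} z)) \<longlonglongrightarrow> 0)"

text \<open>
  Here \<open>a\<close> enumerates an index set without singular parts, \<open>J\<close> spreads a sequence out along \<open>a\<close>, and
  \<open>Q\<close> reads off the coordinates along \<open>a\<close>.
\<close>

lemma compression_to_tail_null:
  fixes T :: "'a::banach linf \<Rightarrow>\<^sub>L 'a linf" and f :: "nat \<Rightarrow> 'a \<Rightarrow> real"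
  assumes f: "\<And>j. bounded_linear (f j)"
  obtains a :: "nat \<Rightarrow> nat" and J Q :: "'a linf \<Rightarrow>\<^sub>L 'a linf"
  where "\<And>k x. J (single k x) = single (a k) x"
    "\<And>z k. apply_bcontfun (Q z) k = apply_bcontfun z (a k)"
    "\<And>k j. tail_null (\<lambda>z. f j (apply_bcontfun ((Q o\<^sub>L T o\<^sub>L J) z) k))"
proof -
  define \<phi> where "\<phi> n z = f (snd (prod_decode n)) (apply_bcontfun (T z) (fst (prod_decode n)))" for n z
  have "bounded_linear (\<phi> n)" for n
    unfolding \<phi>_def
    by (rule bounded_linear_compose[OF f]
        bounded_linear_compose[OF bounded_linear_apply blinfun.bounded_linear_right])+
  then obtain I where inf: "infinite I"
    and null: "\<And>n. \<forall>z. (\<forall>i. i \<notin> I \<longrightarrow> apply_bcontfun z i = 0) \<longrightarrow>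
      (\<lambda>N. \<phi> n (restrict_linf {N..} z)) \<longlonglongrightarrow> 0"
    by (rule singular_free_subset[of \<phi>]) (rule that)
  define a where "a = enumerate I"
  have mono: "strict_mono a" using inf by (simp add: a_def strict_mono_enumerate)
  then have inj: "inj a" by (rule strict_mono_imp_inj_on)
  have ran: "range a = I" using inf by (simp add: a_def range_enumerate)
  define F where "F z i = (if i \<in> I then apply_bcontfun z (inv a i) else 0)"
    for z :: "'a linf" and i
  have F: "F (y + z) i = F y i + F z i" "F (c *\<^sub>R z) i = c *\<^sub>R F z i" "norm (F z i) \<le> 1 * norm z"
    for y z c i
    by (simp_all add: F_def norm_bounded)
  obtain J :: "'a linf \<Rightarrow>\<^sub>L 'a linf" where J': "\<And>z i. apply_bcontfun (J z) i = F z i"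
    by (rule linf_operator[OF F zero_le_one]) (rule that)
  note J = J'[unfolded F_def]
  have sel: "norm (apply_bcontfun z (a i)) \<le> 1 * norm z" for z :: "'a linf" and i
    by (simp add: norm_bounded)
  obtain Q :: "'a linf \<Rightarrow>\<^sub>L 'a linf" where
    Q: "\<And>z k. apply_bcontfun (Q z) k = apply_bcontfun z (a k)"
    by (rule linf_operator[where F = "\<lambda>z k. apply_bcontfun z (a k)", OF _ _ sel zero_le_one]; (rule that)?) simp_all
  have J_restrict: "J (restrict_linf {N..} z) = restrict_linf {a N..} (J z)" for N z
  proof (rule bcontfun_eqI)
    fix i
    show "apply_bcontfun (J (restrict_linf {N..} z)) i = apply_bcontfun (restrict_linf {a N..} (J z)) i"
    proof (cases "i \<in> I")
      case True
      then obtain m where m: "i = a m" using ran by blast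
      then show ?thesis using True inj mono
        by (simp add: J apply_restrict_linf inv_f_f strict_mono_less_eq)
    qed (simp add: J apply_restrict_linf)
  qed
  show ?thesis
  proof (rule that[OF _ Q])
    show "J (single k x) = single (a k) x" for k x
    proof (rule bcontfun_eqI)
      fix i
      show "apply_bcontfun (J (single k x)) i = apply_bcontfun (single (a k) x) i"
      proof (cases "i \<in> I")
        case True
        then obtain m where m: "i = a m" using ran by blast
        then show ?thesis using True inj by (auto simp: J apply_single inv_f_f dest: injD)
      next
        case False
        then have "i \<noteq> a k" using ran by blast
        then show ?thesis using False by (simp add: J apply_single)
      qed
    qed
    show "tail_null (\<lambda>z. f j (apply_bcontfun ((Q o\<^sub>L T o\<^sub>L J) z) k))" for k j
      unfolding tail_null_def
    proof
      fix z
      have "(\<lambda>N. \<phi> (prod_encode (a k, j)) (restrict_linf {N..} (J z))) \<longlonglongrightarrow> 0"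
        by (rule null[rule_format]) (simp add: J)
      then have "((\<lambda>N. \<phi> (prod_encode (a k, j)) (restrict_linf {N..} (J z))) \<circ> a) \<longlonglongrightarrow> 0"
        using mono by (rule LIMSEQ_subseq_LIMSEQ)
      then show "(\<lambda>N. f j (apply_bcontfun ((Q o\<^sub>L T o\<^sub>L J) (restrict_linf {N..} z)) k)) \<longlonglongrightarrow> 0"
        by (simp add: \<phi>_def Q J_restrict o_def)
    qed
  qed
qed

section \<open>Legal moves of Player I and their use\<close>

text \<open>
  Each further functional lowers the dimension by at most one.
\<close>

lemma kernel_in_cof:
  fixes \<phi> :: "'i \<Rightarrow> 'b::real_normed_vector \<Rightarrow> real"
  assumes "finite I" and lin: "\<And>i. i \<in> I \<Longrightarrow> linear (\<phi> i)"
  shows "{v. \<forall>i\<in>I. \<phi> i v = 0} \<in> cof UNIV"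
proof -
  have sub: "subspace {v. \<forall>i\<in>J. \<phi> i v = 0}" if "J \<subseteq> I" for J
    unfolding subspace_def using lin that by (auto simp: linear_0 linear_add linear_scale subset_iff)
  have "\<exists>F. finite F \<and> (UNIV :: 'b set) \<subseteq> span ({v. \<forall>i\<in>J. \<phi> i v = 0} \<union> F)" if "finite J" "J \<subseteq> I" for J
    using that
  proof (induction J)
    case empty
    then show ?case by (intro exI[of _ "{}"]) (simp add: span_UNIV)
  next
    case (insert j J)
    let ?W = "{v. \<forall>i\<in>J. \<phi> i v = 0}" and ?W' = "{v. \<forall>i\<in>insert j J. \<phi> i v = 0}"
    obtain F where F: "finite F" "(UNIV :: 'b set) \<subseteq> span (?W \<union> F)"
      using insert.IH[OF subset_trans[OF subset_insertI insert.prems]] by (elim exE conjE)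
    show ?case
    proof (cases "\<exists>v\<in>?W. \<phi> j v \<noteq> 0")
      case False
      then have "?W' = ?W" by auto
      then show ?thesis using F by (intro exI[of _ F]) (simp only: simp_thms)
    next
      case True
      then obtain u where u: "u \<in> ?W" "\<phi> j u \<noteq> 0" by blast
      have "w \<in> span (?W' \<union> insert u F)" if w: "w \<in> ?W" for w
      proof -
        let ?q = "\<phi> j w / \<phi> j u"
        have "w - ?q *\<^sub>R u \<in> ?W'"
        proof (intro CollectI ballI)
          fix i assume i: "i \<in> insert j J"
          then have "linear (\<phi> i)" using insert.prems lin by blast
          then have "\<phi> i (w - ?q *\<^sub>R u) = \<phi> i w - ?q * \<phi> i u"
            by (simp add: linear_diff linear_scale)
          then show "\<phi> i (w - ?q *\<^sub>R u) = 0" using i u w by auto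
        qed
        then have "(w - ?q *\<^sub>R u) + ?q *\<^sub>R u \<in> span (?W' \<union> insert u F)"
          by (intro span_add span_scale) (auto intro: span_base)
        then show ?thesis by simp
      qed
      then have "?W \<union> F \<subseteq> span (?W' \<union> insert u F)" by (auto intro: span_base)
      then have "span (?W \<union> F) \<subseteq> span (?W' \<union> insert u F)"
        by (rule span_minimal) (rule subspace_span)
      then show ?thesis using F by (intro exI[of _ "insert u F"]) auto
    qed
  qed
  from this[OF assms(1) subset_refl] sub[OF subset_refl] show ?thesis
    by (simp add: cof_def)
qed

text \<open>
  Each further point costs at most one dimension, and evaluation at a point is \<open>w\<^sup>*\<close>-continuous.
\<close>

lemma annihilator_in_cof_wstar:
  fixes U :: "'b::real_normed_vector set"
  assumes "finite U"
  shows "{g \<in> dual_on UNIV. \<forall>u\<in>U. g u = 0} \<in> cof_wstar UNIV"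
proof -
  let ?G = "\<lambda>V. {g \<in> dual_on (UNIV :: 'b set). \<forall>u\<in>V. g u = 0}"
  have bl: "g \<in> dual_on (UNIV :: 'b set) \<longleftrightarrow> bounded_linear g" for g
    by (simp add: dual_on_UNIV)
  have "\<exists>F. finite F \<and> F \<subseteq> dual_on UNIV \<and>
      (\<forall>f\<in>dual_on UNIV. \<exists>g\<in>?G V. \<exists>c. f = (\<lambda>x. g x + (\<Sum>h\<in>F. c h * h x)))" if "finite V" for V
    using that
  proof (induction V)
    case empty
    then show ?case by (intro exI[of _ "{}"]) auto
  next
    case (insert u V)
    then obtain F where F: "finite F" "F \<subseteq> dual_on UNIV"
      and dec: "\<And>f. f \<in> dual_on UNIV \<Longrightarrow> \<exists>g\<in>?G V. \<exists>c. f = (\<lambda>x. g x + (\<Sum>h\<in>F. c h * h x))"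
      by blast
    show ?case
    proof (cases "\<exists>h\<in>?G V. h u \<noteq> 0")
      case False
      then have "?G (insert u V) = ?G V" by auto
      with F dec show ?thesis by (intro exI[of _ F]) simp
    next
      case True
      then obtain h0 where h0: "h0 \<in> ?G V" "h0 u \<noteq> 0" by blast
      have "\<exists>g\<in>?G (insert u V). \<exists>c. f = (\<lambda>x. g x + (\<Sum>h\<in>insert h0 F. c h * h x))"
        if "f \<in> dual_on UNIV" for f
      proof -
        obtain g c where g: "g \<in> ?G V" and f: "f = (\<lambda>x. g x + (\<Sum>h\<in>F. c h * h x))"
          using dec[OF \<open>f \<in> dual_on UNIV\<close>] by blast
        define q where "q = g u / h0 u"
        \<comment> \<open>\<open>h0\<close> may already belong to \<open>F\<close>, so its coefficient is added\<close>
        define c' where "c' h = (if h \<in> F then c h else 0) + (if h = h0 then q else 0)" for h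
        have sum: "(\<Sum>h\<in>insert h0 F. c' h * h x) = (\<Sum>h\<in>F. c h * h x) + q * h0 x" for x
        proof -
          have "(\<Sum>h\<in>insert h0 F. c' h * h x) = (\<Sum>h\<in>insert h0 F. (if h \<in> F then c h else 0) * h x)
              + (\<Sum>h\<in>insert h0 F. (if h = h0 then q else 0) * h x)"
            by (simp only: c'_def distrib_right sum.distrib)
          also have "(\<Sum>h\<in>insert h0 F. (if h \<in> F then c h else 0) * h x) = (\<Sum>h\<in>F. c h * h x)"
            using F(1) by (intro sum.mono_neutral_cong_right) auto
          also have "(\<Sum>h\<in>insert h0 F. (if h = h0 then q else 0) * h x) = (\<Sum>h\<in>{h0}. q * h x)"
            using F(1) by (intro sum.mono_neutral_cong_right) auto
          finally show ?thesis by simp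
        qed
        have "bounded_linear (\<lambda>x. g x - q * h0 x)"
          using g h0 by (intro bounded_linear_sub bounded_linear_const_mult) (auto simp: bl)
        then have "(\<lambda>x. g x - q * h0 x) \<in> ?G (insert u V)"
          using g h0 by (auto simp: bl q_def)
        moreover have "f = (\<lambda>x. (g x - q * h0 x) + (\<Sum>h\<in>insert h0 F. c' h * h x))"
          by (simp add: f sum del: sum.insert)
        ultimately show ?thesis by (intro bexI exI)
      qed
      then show ?thesis using F h0(1) by (intro exI[of _ "insert h0 F"]) auto
    qed
  qed
  note codim = this[OF assms]
  have "closed {g. \<forall>u\<in>U. g u = (0::real)}"
  proof -
    have "closed {g :: 'b \<Rightarrow> real. g u = 0}" for u
      by (intro closed_Collect_eq continuous_on_const continuous_on_product_coordinates)
    then have "closed (\<Inter>u\<in>U. {g :: 'b \<Rightarrow> real. g u = 0})" by blast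
    moreover have "(\<Inter>u\<in>U. {g. g u = (0::real)}) = {g. \<forall>u\<in>U. g u = 0}" by blast
    ultimately show ?thesis by simp
  qed
  then have "closedin (top_of_set (dual_on UNIV)) (dual_on UNIV \<inter> {g. \<forall>u\<in>U. g u = (0::real)})"
    by (rule closedin_closed_Int)
  moreover have "dual_on UNIV \<inter> {g. \<forall>u\<in>U. g u = (0::real)} = ?G U" by blast
  ultimately have "closedin (top_of_set (dual_on UNIV)) (?G U)" by simp
  then show ?thesis
    unfolding cof_wstar_def using codim
    by (auto simp: bl intro: bounded_linear_add bounded_linear_const_mult)
qed

lemma infdist_less_obtain:
  assumes "infdist x W < r" "W \<noteq> {}"
  obtains w where "w \<in> W" "dist x w < r"
proof -
  have "(INF w\<in>W. dist x w) < r" using assms by (simp add: infdist_def)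
  moreover have "bdd_below (dist x ` W)" by (rule bdd_belowI2[of _ 0]) simp
  ultimately show ?thesis using that assms(2) by (auto simp: cINF_less_iff)
qed

text \<open>
  How a challenge in the dual is exploited: a functional close to a space of functionals that vanish at
  \<open>v\<close> is small at \<open>v\<close>.
\<close>

lemma dual_infdist_less_bound:
  assumes d: "dual_infdist f G < r" and f: "bounded_linear f"
    and G: "G \<subseteq> dual_on UNIV" "G \<noteq> {}" and v: "\<And>g. g \<in> G \<Longrightarrow> g v = 0"
  shows "\<bar>f v\<bar> \<le> r * norm v"
proof -
  have bl: "bounded_linear (\<lambda>x. f x - g x)" if "g \<in> G" for g
    using f that G(1) by (auto simp: dual_on_UNIV intro: bounded_linear_sub)
  have "bdd_below ((\<lambda>g. onorm (\<lambda>x. f x - g x)) ` G)"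
    by (rule bdd_belowI2[of _ 0]) (rule onorm_pos_le[OF bl])
  then obtain g where g: "g \<in> G" "onorm (\<lambda>x. f x - g x) < r"
    using d G(2) by (auto simp: dual_infdist_def cINF_less_iff)
  have "\<bar>f v\<bar> = norm (f v - g v)" using v[OF g(1)] by simp
  also have "\<dots> \<le> onorm (\<lambda>x. f x - g x) * norm v" by (rule onorm[OF bl[OF g(1)]])
  also have "\<dots> \<le> r * norm v" using g(2) by (intro mult_right_mono) auto
  finally show ?thesis .
qed

section \<open>Playing all the component games at once\<close>

context schauder
begin

lemma bounded_linear_block_functional: "bounded_linear (block_functional UNIV e r s)"
  unfolding block_functional_def[abs_def]
  by (intro bounded_linear_sum bounded_linear_const_mult bounded_linear_cf)

lemma block_pairing:
  assumes "linear L"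
  shows "block_functional UNIV e r s (L (block_vector e r s)) =
    (\<Sum>i\<in>supp r. \<Sum>j\<in>supp r. s i * s j * (mu r i * lam r j * cf i (L (e j))))"
proof -
  have "cf i (L (block_vector e r s)) = (\<Sum>j\<in>supp r. s j * lam r j * cf i (L (e j)))" for i
    unfolding block_vector_def
    by (simp add: linear_sum[OF assms] linear_scale[OF assms] cf_sum cf_scaleR)
  then show ?thesis
    by (simp add: block_functional_def sum_distrib_left mult_ac)
qed

end

text \<open>
  The set-up for the second half of the argument: \<open>T\<close> has diagonal at least \<open>\<delta>\<close>, Player II follows \<open>\<sigma>\<close> in every
  component, and \<open>t\<close> scales all tolerances of Player I.
\<close>

locale play = schauder +
  fixes T :: "'a linf \<Rightarrow>\<^sub>L 'a linf" and \<sigma> :: "'a strategy" and C \<delta> t :: real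
  assumes win: "winning_strategy UNIV e C (1/2) \<sigma>"
    and \<delta>: "0 < \<delta>" and t: "0 < t"
    and large: "\<And>k j. \<delta> \<le> \<bar>array_coord e k j (T (array e k j))\<bar>"
begin

definition diag_entry :: "nat \<Rightarrow> nat \<Rightarrow> real" where
  "diag_entry k j = array_coord e k j (T (array e k j))"

definition side_partition :: "nat \<Rightarrow> nat set \<times> nat set" where
  "side_partition k = ({j. 0 < diag_entry k j}, {j. \<not> 0 < diag_entry k j})"

definition comp_of :: "nat \<Rightarrow> nat" where "comp_of n = fst (prod_decode n)"
definition turn_of :: "nat \<Rightarrow> nat" where "turn_of n = snd (prod_decode n)"

text \<open>
  A history \<open>h\<close> lists the challenge and the signs of Player I for all turns of the interleaved play. Turn \<open>n\<close>
  is turn \<open>turn_of n\<close> of the game in component \<open>comp_of n\<close>, and the response there sees the moves in this component only.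
\<close>

definition resp :: "(nat \<Rightarrow> 'a challenge \<times> (nat \<Rightarrow> real)) \<Rightarrow> nat \<Rightarrow> response" where
  "resp h n = reply \<sigma> (side_partition (comp_of n))
     (\<lambda>i. fst (h (prod_encode (comp_of n, i)))) (\<lambda>i. snd (h (prod_encode (comp_of n, i)))) (turn_of n)"

definition vec :: "(nat \<Rightarrow> 'a challenge \<times> (nat \<Rightarrow> real)) \<Rightarrow> nat \<Rightarrow> 'a" where
  "vec h n = block_vector e (resp h n) (snd (h n))"

definition func :: "(nat \<Rightarrow> 'a challenge \<times> (nat \<Rightarrow> real)) \<Rightarrow> nat \<Rightarrow> 'a \<Rightarrow> real" where
  "func h n = block_functional UNIV e (resp h n) (snd (h n))"

definition entry :: "nat \<Rightarrow> nat \<Rightarrow> 'a \<Rightarrow> 'a" where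
  "entry k l v = apply_bcontfun (T (single l v)) k"

text \<open>
  Player I's challenge at turn \<open>n\<close>. The annihilated basis vectors make \<open>\<bar>f k i (e j)\<bar>\<close> summable in \<open>i\<close>, as
  \<open>block_analysis\<close> requires. The tolerance \<open>4\<^sup>-\<^sup>n\<close> is at most \<open>2\<^sup>-\<^sup>m 2\<^sup>-\<^sup>n\<close> for every \<open>m \<le> n\<close>, which leaves
  a summable bound for the whole matrix.
\<close>

definition chall :: "(nat \<Rightarrow> 'a challenge \<times> (nat \<Rightarrow> real)) \<Rightarrow> nat \<Rightarrow> 'a challenge" where
  "chall h n = Challenge (t * (1/4) ^ n)
     {v. \<forall>m\<in>{..<n}. func h m (entry (comp_of m) (comp_of n) v) = 0}
     {g \<in> dual_on UNIV. \<forall>u\<in>(\<lambda>m. entry (comp_of n) (comp_of m) (vec h m)) ` {..<n} \<union> e ` {..turn_of n}. g u = 0}"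

text \<open>
  The last condition bounds the modulus of the new diagonal entry of \<open>T\<close> from below by that of its average over all signs.
\<close>

definition good :: "(nat \<Rightarrow> 'a challenge \<times> (nat \<Rightarrow> real)) \<Rightarrow> nat \<Rightarrow> bool" where
  "good h n \<longleftrightarrow> fst (h n) = chall h n \<and> snd (h n) \<in> supp (resp h n) \<rightarrow>\<^sub>E {-1, 1} \<and>
     \<bar>\<Sum>i\<in>supp (resp h n). mu (resp h n) i * lam (resp h n) i * diag_entry (comp_of n) i\<bar>
       \<le> \<bar>func h n (entry (comp_of n) (comp_of n) (vec h n))\<bar>"

lemma prod_encode_of [simp]: "prod_encode (comp_of n, turn_of n) = n"
  by (simp add: comp_of_def turn_of_def)

lemma of_prod_encode [simp]: "comp_of (prod_encode (k, i)) = k" "turn_of (prod_encode (k, i)) = i"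
  by (simp_all add: comp_of_def turn_of_def)

lemma prod_encode_less:
  assumes "i < turn_of n"
  shows "prod_encode (comp_of n, i) < n"
proof -
  have "prod_encode (comp_of n, i) < prod_encode (comp_of n, turn_of n)"
    by (rule lift_Suc_mono_less[OF _ assms]) (simp add: prod_encode_def)
  then show ?thesis by simp
qed

text \<open>
  The response is given before the signs of turn \<open>n\<close> are chosen, so of the record for turn \<open>n\<close> only the
  challenge matters.
\<close>

lemma resp_cong:
  assumes "\<And>m. m < n \<Longrightarrow> h m = g m" "fst (h n) = fst (g n)"
  shows "resp h n = resp g n"
proof -
  have "fst (h (prod_encode (comp_of n, i))) = fst (g (prod_encode (comp_of n, i)))"
    if "i < Suc (turn_of n)" for i
    using that assms prod_encode_less[of i n] by (cases "i = turn_of n") auto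
  moreover have "snd (h (prod_encode (comp_of n, i))) = snd (g (prod_encode (comp_of n, i)))"
    if "i < turn_of n" for i
    using that assms prod_encode_less[of i n] by auto
  ultimately have "map (\<lambda>i. fst (h (prod_encode (comp_of n, i)))) [0..<Suc (turn_of n)]
      = map (\<lambda>i. fst (g (prod_encode (comp_of n, i)))) [0..<Suc (turn_of n)]"
    "map (\<lambda>i. snd (h (prod_encode (comp_of n, i)))) [0..<turn_of n]
      = map (\<lambda>i. snd (g (prod_encode (comp_of n, i)))) [0..<turn_of n]"
    by (auto simp del: upt_Suc)
  then show ?thesis by (simp only: resp_def reply_def)
qed

lemma vec_func_cong:
  assumes "\<And>m. m \<le> n \<Longrightarrow> h m = g m"
  shows "vec h n = vec g n" "func h n = func g n"
  using resp_cong[of n h g] assms by (simp_all add: vec_def func_def)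

lemma chall_cong:
  assumes "\<And>m. m < n \<Longrightarrow> h m = g m"
  shows "chall h n = chall g n"
proof -
  have eq: "vec h m = vec g m" "func h m = func g m" if "m < n" for m
    using vec_func_cong[of m h g] assms that by auto
  have "(\<lambda>m. entry (comp_of n) (comp_of m) (vec h m)) ` {..<n}
      = (\<lambda>m. entry (comp_of n) (comp_of m) (vec g m)) ` {..<n}"
    by (rule image_cong) (simp_all add: eq)
  then show ?thesis by (simp add: chall_def eq)
qed

lemma good_cong:
  assumes "\<And>m. m \<le> n \<Longrightarrow> h m = g m"
  shows "good h n \<longleftrightarrow> good g n"
  using assms resp_cong[of n h g] vec_func_cong[of n h g] chall_cong[of n h g]
  by (simp add: good_def)

lemma linear_entry: "linear (entry k l)"
  unfolding entry_def
  by (rule linearI) (simp_all add: single_simps blinfun.add_right blinfun.scaleR_right)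

lemma diag_entry_eq: "diag_entry k i = cf i (entry k k (e i))"
  by (simp add: diag_entry_def array_coord_def entry_def array_def)

text \<open>
  By \<open>block_pairing\<close> the new diagonal entry of \<open>T\<close> is a quadratic form in the signs whose trace is
  the sum in \<open>good\<close>.
\<close>

lemma good_extension: "\<exists>r. good (h(n := r)) n"
proof -
  define c where "c = chall h n"
  \<comment> \<open>the signs at \<open>n\<close> are a placeholder: they are chosen after the response\<close>
  define R where "R = resp (h(n := (c, undefined))) n"
  have R: "resp (h(n := (c, s))) n = R" for s
    unfolding R_def by (rule resp_cong) auto
  have c: "chall (h(n := (c, s))) n = c" for s
    unfolding c_def by (rule chall_cong) auto
  obtain s where s: "s \<in> supp R \<rightarrow>\<^sub>E {-1, 1}"
    "\<bar>\<Sum>i\<in>supp R. mu R i * lam R i * cf i (entry (comp_of n) (comp_of n) (e i))\<bar> \<le>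
     \<bar>\<Sum>i\<in>supp R. \<Sum>j\<in>supp R. s i * s j * (mu R i * lam R j * cf i (entry (comp_of n) (comp_of n) (e j)))\<bar>"
    using signs_abs_quadratic_form[of "supp R"
        "\<lambda>i j. mu R i * lam R j * cf i (entry (comp_of n) (comp_of n) (e j))"] by blast
  have "good (h(n := (c, s))) n"
    unfolding good_def R c vec_def func_def
    using s by (simp add: block_pairing[OF linear_entry] diag_entry_eq)
  then show ?thesis by blast
qed

text \<open>
  Whether turn \<open>n\<close> is good depends on the history up to \<open>n\<close> only, so the moves of Player I
  can be chosen recursively.
\<close>

lemma good_history: "\<exists>h. \<forall>n. good h n"
proof -
  have "\<exists>h. \<forall>n. good (h(n := h n)) n"
  proof (rule dependent_wellorder_choice)
    show "good (h(n := r)) n = good (g(n := r)) n" if "\<And>m. m < n \<Longrightarrow> h m = g m" for h g n r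
      by (rule good_cong) (use that in auto)
  qed (rule good_extension)
  then show ?thesis by simp
qed

lemma legal_chall: "legal_challenge UNIV (chall h n)"
proof -
  have "linear (\<lambda>v. func h m (entry k l v))" for m k l
    using linear_compose[OF linear_entry bounded_linear.linear[OF bounded_linear_block_functional]]
    by (simp add: func_def o_def)
  then show ?thesis
    unfolding legal_challenge_def chall_def using t
    by (auto intro!: kernel_in_cof annihilator_in_cof_wstar)
qed

text \<open>
  On either side of the partition the diagonal entries of \<open>T\<close> have one sign and modulus at least
  \<open>\<delta>\<close>, so the average over signs of the new diagonal entry has modulus at least \<open>\<delta> \<Sum>\<lambda>\<^sub>i \<mu>\<^sub>i > \<delta> / 2\<close>.
  The last two bounds combine into a bound for every off-diagonal entry: in a pair of distinct turns, the later
  one was played against the challenge that was formed from the earlier one.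
\<close>

lemma play_outcome:
  obtains x :: "nat \<Rightarrow> nat \<Rightarrow> 'a" and f :: "nat \<Rightarrow> nat \<Rightarrow> 'a \<Rightarrow> real"
  where
    "\<And>k i. \<exists>I a. finite I \<and> f k i = (\<lambda>v. \<Sum>j\<in>I. a j * cf j v)"
    "\<And>k a. finite {i. a i \<noteq> 0} \<Longrightarrow> comb_norm (x k) a \<le> sqrt (C + 1/2) * comb_norm e a"
    "\<And>k a. finite {i. a i \<noteq> 0} \<Longrightarrow> dual_comb_norm (f k) a \<le> sqrt (C + 1/2) * dual_comb_norm cf a"
    "\<And>k i. \<delta> / 2 \<le> \<bar>f k i (entry k k (x k i))\<bar>"
    "\<And>k i j. j \<le> i \<Longrightarrow> \<bar>f k i (e j)\<bar> \<le> t * (1/4) ^ prod_encode (k, i)"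
    "\<And>k i l j. prod_encode (l, j) < prod_encode (k, i) \<Longrightarrow>
      \<bar>f k i (entry k l (x l j))\<bar> \<le> t * (1/4) ^ prod_encode (k, i) * norm (entry k l (x l j))"
    "\<And>k i l j. prod_encode (l, j) < prod_encode (k, i) \<Longrightarrow>
      \<bar>f l j (entry l k (x k i))\<bar> \<le> t * (1/4) ^ prod_encode (k, i) * onorm (\<lambda>v. f l j (entry l k v))"
proof -
  obtain h where good: "\<And>n. good h n" using good_history by blast
  define x where "x k i = vec h (prod_encode (k, i))" for k i
  define f where "f k i = func h (prod_encode (k, i))" for k i
  define ch where "ch k i = fst (h (prod_encode (k, i)))" for k i
  define sg where "sg k i = snd (h (prod_encode (k, i)))" for k i
  define r where "r k = reply \<sigma> (side_partition k) (ch k) (sg k)" for k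
  have resp: "resp h (prod_encode (k, i)) = r k i" for k i
    by (simp add: resp_def r_def ch_def[abs_def] sg_def[abs_def])
  have ch: "ch k i = chall h (prod_encode (k, i))" for k i
    using good[of "prod_encode (k, i)"] by (simp add: good_def ch_def)
  have sg: "sg k i \<in> supp (r k i) \<rightarrow>\<^sub>E {-1, 1}" for k i
    using good[of "prod_encode (k, i)"] by (simp add: good_def sg_def resp)
  have diag: "\<bar>\<Sum>j\<in>supp (r k i). mu (r k i) j * lam (r k i) j * diag_entry k j\<bar> \<le> \<bar>f k i (entry k k (x k i))\<bar>"
    for k i
    using good[of "prod_encode (k, i)"] by (simp add: good_def f_def x_def resp)
  have x: "x k = (\<lambda>i. block_vector e (r k i) (sg k i))"
    and f: "f k = (\<lambda>i. block_functional UNIV e (r k i) (sg k i))" for k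
    by (simp_all add: fun_eq_iff x_def f_def vec_def func_def resp sg_def)
  have lin_f: "bounded_linear (f k i)" for k i
    by (simp add: f bounded_linear_block_functional)
  have "fst (side_partition k) \<union> snd (side_partition k) = UNIV \<and>
      fst (side_partition k) \<inter> snd (side_partition k) = {}" for k
    by (auto simp: side_partition_def)
  then have won: "(\<forall>i. legal_response (1/2) (side_partition k) (r k i)) \<and>
      impartially_equivalent (C + 1/2) (comb_norm (x k)) (comb_norm e) \<and>
      impartially_equivalent (C + 1/2) (dual_comb_norm (f k)) (dual_comb_norm cf) \<and>
      (\<forall>i. infdist (x k i) (space_part (ch k i)) < tol (ch k i)) \<and>
      (\<forall>i. dual_infdist (f k i) (dual_part (ch k i)) < tol (ch k i))" for k
    using win[unfolded winning_strategy_def Let_def, rule_format,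
        of "fst (side_partition k)" "snd (side_partition k)" "ch k" "sg k"]
    using legal_chall sg by (simp add: ch x f flip: r_def)
  show ?thesis
  proof (rule that[of f x])
    fix k i
    show "\<exists>I a. finite I \<and> f k i = (\<lambda>v. \<Sum>j\<in>I. a j * cf j v)"
      using won[of k] by (auto simp: f block_functional_def[abs_def] legal_response_def)
    show "\<delta> / 2 \<le> \<bar>f k i (entry k k (x k i))\<bar>"
    proof -
      define R where "R = r k i"
      have R: "side R \<in> {1, 2}" "supp R \<subseteq> (if side R = 1 then {j. 0 < diag_entry k j} else {j. \<not> 0 < diag_entry k j})"
        "\<And>j. j \<in> supp R \<Longrightarrow> 0 \<le> lam R j \<and> 0 \<le> mu R j" "1/2 < (\<Sum>j\<in>supp R. lam R j * mu R j)"
      proof -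
        have "legal_response (1/2) (side_partition k) R" using won[of k] by (simp add: R_def)
        then show "side R \<in> {1, 2}" "supp R \<subseteq> (if side R = 1 then {j. 0 < diag_entry k j} else {j. \<not> 0 < diag_entry k j})"
          "\<And>j. j \<in> supp R \<Longrightarrow> 0 \<le> lam R j \<and> 0 \<le> mu R j" "1/2 < (\<Sum>j\<in>supp R. lam R j * mu R j)"
          unfolding legal_response_def side_partition_def fst_conv snd_conv by simp_all
      qed
      \<comment> \<open>the common sign of the diagonal entries on the side that Player II chose\<close>
      define \<epsilon> :: real where "\<epsilon> = (if side R = 1 then 1 else -1)"
      have "\<delta> \<le> \<epsilon> * diag_entry k j" if "j \<in> supp R" for j
        using large[of k j] R(2) that by (auto simp: \<epsilon>_def diag_entry_def split: if_splits)
      then have "(\<Sum>j\<in>supp R. \<delta> * (lam R j * mu R j)) \<le> (\<Sum>j\<in>supp R. (\<epsilon> * diag_entry k j) * (lam R j * mu R j))"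
        using R(3) by (intro sum_mono mult_right_mono) auto
      then have "\<delta> * (\<Sum>j\<in>supp R. lam R j * mu R j) \<le> \<epsilon> * (\<Sum>j\<in>supp R. mu R j * lam R j * diag_entry k j)"
        by (simp add: sum_distrib_left mult_ac)
      moreover have "\<delta> * (1/2) \<le> \<delta> * (\<Sum>j\<in>supp R. lam R j * mu R j)"
        using R(4) \<delta> by (intro mult_left_mono) auto
      moreover have "\<epsilon> * (\<Sum>j\<in>supp R. mu R j * lam R j * diag_entry k j)
          \<le> \<bar>\<Sum>j\<in>supp R. mu R j * lam R j * diag_entry k j\<bar>"
        using abs_ge_self abs_ge_minus_self by (auto simp: \<epsilon>_def)
      ultimately show ?thesis using diag[of k i] by (simp add: R_def)
    qed
  next
    fix k and a :: "nat \<Rightarrow> real" assume "finite {i. a i \<noteq> 0}"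
    then show "comb_norm (x k) a \<le> sqrt (C + 1/2) * comb_norm e a"
      "dual_comb_norm (f k) a \<le> sqrt (C + 1/2) * dual_comb_norm cf a"
      using won[of k] unfolding impartially_equivalent_def by blast+
  next
    fix k i
    let ?n = "prod_encode (k, i)"
    have tol: "tol (ch k i) = t * (1/4) ^ ?n" by (simp add: ch chall_def)
    have annih: "\<bar>f k i u\<bar> \<le> t * (1/4) ^ ?n * norm u"
      if u: "u \<in> (\<lambda>m. entry k (comp_of m) (vec h m)) ` {..<?n} \<union> e ` {..i}" for u
    proof (rule dual_infdist_less_bound)
      show "dual_infdist (f k i) (dual_part (ch k i)) < t * (1/4) ^ ?n"
        using won[of k] tol by metis
      show "dual_part (ch k i) \<subseteq> dual_on UNIV" by (auto simp: ch chall_def)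
      show "dual_part (ch k i) \<noteq> {}"
      proof -
        have "(\<lambda>_. 0) \<in> dual_part (ch k i)"
          by (simp add: ch chall_def dual_on_UNIV)
        then show ?thesis by blast
      qed
      show "g u = 0" if "g \<in> dual_part (ch k i)" for g
        using that u by (auto simp: ch chall_def)
    qed (rule lin_f)
    show "\<bar>f k i (e j)\<bar> \<le> t * (1/4) ^ ?n" if "j \<le> i" for j
      using annih[of "e j"] that by simp
    fix l j
    let ?m = "prod_encode (l, j)"
    assume less: "?m < ?n"
    have "entry k l (x l j) = entry k (comp_of ?m) (vec h ?m)" by (simp add: x_def)
    then show "\<bar>f k i (entry k l (x l j))\<bar> \<le> t * (1/4) ^ ?n * norm (entry k l (x l j))"
      using less by (intro annih) blast
    have lin: "bounded_linear (\<lambda>v. f l j (entry l k v))"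
      unfolding entry_def
      by (rule bounded_linear_compose[OF lin_f]
          bounded_linear_compose[OF bounded_linear_apply]
          bounded_linear_compose[OF blinfun.bounded_linear_right] bounded_linear_single)+
    have "infdist (x k i) (space_part (ch k i)) < t * (1/4) ^ ?n"
      using won[of k] tol by metis
    moreover have "space_part (ch k i) \<noteq> {}"
    proof -
      have "0 \<in> space_part (ch k i)"
        using linear_0[OF linear_entry] linear_0[OF bounded_linear.linear[OF bounded_linear_block_functional]]
        by (simp add: ch chall_def func_def)
      then show ?thesis by blast
    qed
    ultimately obtain w where w: "w \<in> space_part (ch k i)" "dist (x k i) w < t * (1/4) ^ ?n"
      by (rule infdist_less_obtain)
    have "f l j (entry l k w) = 0"
      using w(1) less by (auto simp: ch chall_def f_def dest: bspec[of _ _ ?m])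
    then have "f l j (entry l k (x k i)) = f l j (entry l k (x k i - w))"
      using linear_diff[OF bounded_linear.linear[OF lin], of "x k i" w] by simp
    then have "\<bar>f l j (entry l k (x k i))\<bar> \<le> onorm (\<lambda>v. f l j (entry l k v)) * norm (x k i - w)"
      using onorm[OF lin, of "x k i - w"] by simp
    also have "\<dots> \<le> onorm (\<lambda>v. f l j (entry l k v)) * (t * (1/4) ^ ?n)"
      using w(2) by (intro mult_left_mono onorm_pos_le[OF lin]) (simp add: dist_norm)
    finally show "\<bar>f l j (entry l k (x k i))\<bar>
        \<le> t * (1/4) ^ ?n * onorm (\<lambda>v. f l j (entry l k v))"
      by (simp add: mult.commute)
  qed
qed

end

section \<open>Perturbing to a componentwise diagonal operator\<close>

lemma componentwise_operator:
  fixes L :: "nat \<Rightarrow> 'a::banach \<Rightarrow> 'a"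
  assumes lin: "\<And>k. bounded_linear (L k)" and bound: "\<And>k v. norm (L k v) \<le> M * norm v"
    and M: "0 \<le> M"
  obtains L' :: "'a linf \<Rightarrow>\<^sub>L 'a linf"
  where "\<And>z k. apply_bcontfun (L' z) k = L k (apply_bcontfun z k)" "norm L' \<le> M"
proof -
  define F where "F z k = L k (apply_bcontfun z k)" for z :: "'a linf" and k
  have F: "F (y + z) k = F y k + F z k" "F (c *\<^sub>R z) k = c *\<^sub>R F z k" for y z c k
    by (simp_all add: F_def linear_add linear_scale bounded_linear.linear[OF lin])
  have F_norm: "norm (F z k) \<le> M * norm z" for z k
    unfolding F_def by (rule order_trans[OF bound mult_left_mono[OF norm_bounded M]])
  show ?thesis
    by (rule linf_operator[OF F F_norm M]) (rule that, simp_all add: F_def)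
qed

lemma linf_split:
  "y = (\<Sum>l<N. single l (apply_bcontfun y l)) + restrict_linf {N..} y"
proof (rule bcontfun_eqI)
  fix i
  have "apply_bcontfun (\<Sum>l<N. single l (apply_bcontfun y l)) i
      = (\<Sum>l<N. if i = l then apply_bcontfun y l else 0)"
    by (simp add: linear_sum[OF linear_apply] apply_single)
  then show "apply_bcontfun y i
      = apply_bcontfun ((\<Sum>l<N. single l (apply_bcontfun y l)) + restrict_linf {N..} y) i"
    by (simp add: apply_restrict_linf)
qed

lemma tail_null_combination:
  assumes "\<And>j. j \<in> I \<Longrightarrow> tail_null (\<phi> j)"
  shows "tail_null (\<lambda>z. \<Sum>j\<in>I. a j * \<phi> j z)"
  unfolding tail_null_def
proof
  fix z
  have "(\<lambda>N. \<Sum>j\<in>I. a j * \<phi> j (restrict_linf {N..} z)) \<longlonglongrightarrow> (\<Sum>j\<in>I. a j * 0)"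
    by (intro tendsto_intros) (use assms in \<open>simp add: tail_null_def\<close>)
  then show "(\<lambda>N. \<Sum>j\<in>I. a j * \<phi> j (restrict_linf {N..} z)) \<longlonglongrightarrow> 0" by simp
qed

lemma half_powers_sum: "(\<Sum>l<N. (1/2::real) ^ l) \<le> 2"
  using sum_le_suminf[of "\<lambda>l. (1/2::real) ^ l" "{..<N}"] suminf_geometric[of "1/2::real"]
  by (simp add: summable_geometric)

lemma quarter_power_le: "(1/4::real) ^ prod_encode (k, i) \<le> (1/4) ^ i"
  by (rule power_decreasing) (simp_all add: le_prod_encode_2)

text \<open>
  The tolerance of the later of two turns, which bounds the entry for these turns, is dominated by a product of
  weights that can be summed over components and indices separately.
\<close>

lemma off_diagonal_weight:
  assumes "prod_encode (k, i) \<le> n" "prod_encode (l, j) \<le> n"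
  shows "(1/4::real) ^ n \<le> (1/2) ^ i * ((1/2) ^ l * (1/2) ^ j)"
proof -
  have "n \<le> triangle n" for n by (induction n) simp_all
  then have "l + j \<le> prod_encode (l, j)" by (simp add: prod_encode_def trans_le_add1)
  moreover have "i \<le> prod_encode (k, i)" by (rule le_prod_encode_2)
  ultimately have "i + (l + j) \<le> 2 * n" using assms by linarith
  then have "(1/2::real) ^ (2 * n) \<le> (1/2) ^ (i + (l + j))"
    by (intro power_decreasing) auto
  then show ?thesis by (simp add: power_mult power_add power2_eq_square)
qed

context schauder
begin

text \<open>
  Expanding \<open>y\<close> in the blocks shows \<open>\<phi> y\<close> as the iterated sum of \<open>cf j (z l) * \<phi> (single l (x l j))\<close>: inside a
  component this is continuity, across components it is order continuity of \<open>\<phi>\<close>. All terms except the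
  one at \<open>(k, i)\<close> are estimated by absolute values.
\<close>

lemma off_diagonal_estimate:
  assumes \<phi>: "bounded_linear \<phi>" and null: "tail_null \<phi>"
    and y: "\<And>l. (\<lambda>j. cf j (apply_bcontfun z l) *\<^sub>R x l j) sums apply_bcontfun y l"
    and M: "\<And>N v. norm (psum N v) \<le> M * norm v"
    and small: "\<And>l j. (l, j) \<noteq> (k, i) \<Longrightarrow> \<bar>\<phi> (single l (x l j))\<bar> \<le> q * ((1/2) ^ l * (1/2) ^ j)"
    and q: "0 \<le> q"
  shows "\<bar>\<phi> y - \<phi> (single k (x k i)) * cf i (apply_bcontfun z k)\<bar> \<le> 8 * M * q * norm z"
proof -
  \<comment> \<open>\<open>g\<close> lists the values of \<open>\<phi>\<close> on the blocks without the one at \<open>(k, i)\<close>\<close>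
  define g where "g l j = (if (l, j) = (k, i) then 0 else \<phi> (single l (x l j)))" for l j
  have M0: "0 \<le> M" using M[of 0 "e 0"] by (simp add: psum_def)
  have cf_le: "\<bar>cf j (apply_bcontfun z l)\<bar> \<le> 2 * M * norm z" for j l
    using order_trans[OF abs_cf_le[OF M, of j "apply_bcontfun z l"], of "2 * M * norm z"]
      mult_left_mono[OF norm_bounded[of z l] M0] by simp
  have g_le: "\<bar>g l j\<bar> \<le> q * ((1/2) ^ l * (1/2) ^ j)" for l j
    using small[of l j] q by (auto simp: g_def)
  define u where "u l j = cf j (apply_bcontfun z l) * g l j" for l j
  have u_le: "\<bar>u l j\<bar> \<le> 2 * M * norm z * (q * (1/2) ^ l) * (1/2) ^ j" for l j
  proof -
    have "\<bar>u l j\<bar> \<le> (2 * M * norm z) * (q * ((1/2) ^ l * (1/2) ^ j))"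
      unfolding u_def abs_mult
      using cf_le g_le M0 by (intro mult_mono) auto
    then show ?thesis by (simp add: mult_ac)
  qed
  have geo: "(\<lambda>j. c * (1/2::real) ^ j) sums (c * 2)" for c
    using geometric_sums[of "1/2::real"] by (intro sums_mult) simp
  have u_summ: "summable (\<lambda>j. \<bar>u l j\<bar>)" for l
    by (rule summable_comparison_test'[OF sums_summable[OF geo], of 0]) (use u_le in simp)
  define U where "U l = (\<Sum>j. u l j)" for l
  have U_le: "\<bar>U l\<bar> \<le> 4 * M * norm z * q * (1/2) ^ l" for l
  proof -
    have "\<bar>U l\<bar> \<le> (\<Sum>j. \<bar>u l j\<bar>)" unfolding U_def by (rule summable_rabs[OF u_summ])
    also have "\<dots> \<le> (2 * M * norm z * (q * (1/2) ^ l)) * 2"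
      using suminf_le[OF u_le u_summ sums_summable[OF geo]] sums_unique[OF geo] by metis
    finally show ?thesis by (simp add: mult_ac)
  qed
  let ?D = "\<phi> (single k (x k i)) * cf i (apply_bcontfun z k)"
  have single: "\<phi> (single l (apply_bcontfun y l)) = U l + (if l = k then ?D else 0)" for l
  proof -
    have "bounded_linear (\<lambda>v. \<phi> (single l v))"
      by (rule bounded_linear_compose[OF \<phi> bounded_linear_single])
    from bounded_linear.sums[OF this y[of l]]
    have "(\<lambda>j. cf j (apply_bcontfun z l) * \<phi> (single l (x l j))) sums \<phi> (single l (apply_bcontfun y l))"
      by (simp add: single_simps linear_scale[OF bounded_linear.linear[OF \<phi>]])
    moreover have "(\<lambda>j. u l j + (if j = i then (if l = k then ?D else 0) else 0))
        sums (U l + (if l = k then ?D else 0))"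
      unfolding U_def
      by (intro sums_add summable_sums summable_rabs_cancel[OF u_summ])
        (use sums_single[of i "\<lambda>_. if l = k then ?D else 0"] in simp)
    moreover have "u l j + (if j = i then (if l = k then ?D else 0) else 0)
        = cf j (apply_bcontfun z l) * \<phi> (single l (x l j))" for j
      by (auto simp: u_def g_def)
    ultimately show ?thesis by (simp add: sums_unique2)
  qed
  have est: "\<bar>\<phi> y - \<phi> (restrict_linf {N..} y) - ?D\<bar> \<le> 8 * M * q * norm z" if "k < N" for N
  proof -
    have "\<phi> y = \<phi> ((\<Sum>l<N. single l (apply_bcontfun y l)) + restrict_linf {N..} y)"
      using linf_split[of y N] by simp
    also have "\<dots> = (\<Sum>l<N. \<phi> (single l (apply_bcontfun y l))) + \<phi> (restrict_linf {N..} y)"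
      using bounded_linear.linear[OF \<phi>] by (simp add: linear_add linear_sum)
    also have "(\<Sum>l<N. \<phi> (single l (apply_bcontfun y l))) = (\<Sum>l<N. U l) + ?D"
      using that by (simp add: single sum.distrib)
    finally have "\<bar>\<phi> y - \<phi> (restrict_linf {N..} y) - ?D\<bar> = \<bar>\<Sum>l<N. U l\<bar>" by simp
    also have "\<dots> \<le> (\<Sum>l<N. 4 * M * norm z * q * (1/2) ^ l)"
      by (rule order_trans[OF sum_abs sum_mono[OF U_le]])
    also have "\<dots> = 4 * M * norm z * q * (\<Sum>l<N. (1/2) ^ l)" by (simp add: sum_distrib_left)
    also have "\<dots> \<le> 4 * M * norm z * q * 2"
      using M0 q by (intro mult_left_mono half_powers_sum) auto
    finally show ?thesis by (simp add: mult_ac)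
  qed
  have "(\<lambda>N. \<bar>\<phi> y - \<phi> (restrict_linf {N..} y) - ?D\<bar>) \<longlonglongrightarrow> \<bar>\<phi> y - 0 - ?D\<bar>"
    by (intro tendsto_intros) (use null in \<open>simp add: tail_null_def\<close>)
  then have "\<bar>\<phi> y - 0 - ?D\<bar> \<le> 8 * M * q * norm z"
    by (rule Lim_bounded[where M = "Suc k"]) (use est in simp)
  then show ?thesis by simp
qed

text \<open>
  Only the product of the norms is controlled by \<open>\<kappa>\<close>. Scaling bounds each factor separately, as is
  needed to combine the factors for all components into operators on \<open>\<ell>\<^sup>\<infinity>(X)\<close>.
\<close>

lemma identity_factors_normalized:
  fixes S :: "'a \<Rightarrow>\<^sub>L 'a"
  assumes "identity_factors \<kappa> S"
  obtains A B :: "'a \<Rightarrow>\<^sub>L 'a" where "norm A \<le> 1" "norm B \<le> \<kappa>" "\<And>v. A (S (B v)) = v"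
proof -
  obtain A B :: "'a \<Rightarrow>\<^sub>L 'a" where AB: "norm A * norm B \<le> \<kappa>" "id_blinfun = A o\<^sub>L S o\<^sub>L B"
    using assms by (auto simp: identity_factors_def)
  have id: "A (S (B v)) = v" for v
    using arg_cong[OF AB(2), of "\<lambda>L. blinfun_apply L v"] by simp
  have "norm A \<noteq> 0"
  proof
    assume "norm A = 0"
    then have "e 0 = 0" using id[of "e 0"] by simp
    then show False using norm_basis[of 0] by simp
  qed
  then have "norm A > 0" by simp
  show ?thesis
  proof (rule that[of "(1 / norm A) *\<^sub>R A" "norm A *\<^sub>R B"])
    show "((1 / norm A) *\<^sub>R A) (S ((norm A *\<^sub>R B) v)) = v" for v
      using \<open>norm A > 0\<close> id by (simp add: blinfun.scaleR_left blinfun.scaleR_right)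
  qed (use \<open>norm A > 0\<close> AB(1) in simp_all)
qed

text \<open>
  The constant \<open>\<kappa>\<close> for factoring through diagonal operators with entries of modulus at least \<open>\<delta> / 2\<close>, the basis
  constant \<open>M\<close>, and the bound \<open>\<beta>\<close> for block vectors and functionals composed with \<open>T\<close> are all known in advance.
  So the tolerance \<open>t\<close> can be taken so small that the remainder \<open>R = A T B - D\<close> satisfies \<open>\<kappa> \<parallel>R\<parallel> < 1\<close>.
\<close>

theorem factorization_of_tail_null_operator:
  fixes T :: "'a linf \<Rightarrow>\<^sub>L 'a linf"
  assumes C: "0 \<le> C" and win: "winning_strategy UNIV e C (1/2) \<sigma>"
    and K: "\<And>\<delta>. \<delta> > 0 \<Longrightarrow> K \<delta> > 0" and dfp: "diagonal_factorization_property K e"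
    and \<delta>: "0 < \<delta>" and large: "\<And>k j. \<delta> \<le> \<bar>array_coord e k j (T (array e k j))\<bar>"
    and null: "\<And>k j. tail_null (\<lambda>z. cf j (apply_bcontfun (T z) k))"
  obtains A B :: "'a linf \<Rightarrow>\<^sub>L 'a linf" where "id_blinfun = A o\<^sub>L T o\<^sub>L B"
proof -
  obtain M where M1: "1 \<le> M" and M: "\<And>N x. norm (psum N x) \<le> M * norm x"
    by (rule psum_uniformly_bounded) (rule that)
  have M0: "0 \<le> M" using M1 by simp
  define c where "c = sqrt (C + 1/2)"
  have c0: "0 \<le> c" using C by (simp add: c_def)
  define \<kappa> where "\<kappa> = K (\<delta> / 2) + 1"
  have \<kappa>: "0 < \<kappa>" using K[of "\<delta> / 2"] \<delta> by (simp add: \<kappa>_def)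
  define \<beta> where "\<beta> = c * (2 * M) * norm T"
  have \<beta>: "0 \<le> \<beta>" using c0 M0 by (simp add: \<beta>_def)
  \<comment> \<open>\<open>16 M t \<beta>\<close> will bound the norm of the remainder, and \<open>+ 1\<close> makes \<open>\<kappa>\<close> times it less than \<open>1\<close>\<close>
  define t where "t = 1 / (\<kappa> * (16 * M * \<beta>) + 1)"
  have pos: "0 < \<kappa> * (16 * M * \<beta>) + 1" using \<kappa> M0 \<beta> by (intro add_nonneg_pos) auto
  then have t: "0 < t" by (simp add: t_def)
  have t_small: "\<kappa> * (16 * M * (t * \<beta>)) < 1"
  proof -
    have "\<kappa> * (16 * M * (t * \<beta>)) = (\<kappa> * (16 * M * \<beta>)) / (\<kappa> * (16 * M * \<beta>) + 1)"
      by (simp add: t_def)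
    also have "\<dots> < 1" using pos by simp
    finally show ?thesis .
  qed
  interpret play e T \<sigma> C \<delta> t
    by unfold_locales (use win \<delta> t large in auto)
  obtain x :: "nat \<Rightarrow> nat \<Rightarrow> 'a" and f :: "nat \<Rightarrow> nat \<Rightarrow> 'a \<Rightarrow> real" where
    f_comb: "\<And>k i. \<exists>I a. finite I \<and> f k i = (\<lambda>v. \<Sum>j\<in>I. a j * cf j v)"
    and x_dom: "\<And>k a. finite {i. a i \<noteq> 0} \<Longrightarrow> comb_norm (x k) a \<le> sqrt (C + 1/2) * comb_norm e a"
    and f_dom: "\<And>k a. finite {i. a i \<noteq> 0} \<Longrightarrow> dual_comb_norm (f k) a \<le> sqrt (C + 1/2) * dual_comb_norm cf a"
    and diag: "\<And>k i. \<delta> / 2 \<le> \<bar>f k i (entry k k (x k i))\<bar>"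
    and f_e: "\<And>k i j. j \<le> i \<Longrightarrow> \<bar>f k i (e j)\<bar> \<le> t * (1/4) ^ prod_encode (k, i)"
    and below: "\<And>k i l j. prod_encode (l, j) < prod_encode (k, i) \<Longrightarrow>
      \<bar>f k i (entry k l (x l j))\<bar> \<le> t * (1/4) ^ prod_encode (k, i) * norm (entry k l (x l j))"
    and above: "\<And>k i l j. prod_encode (l, j) < prod_encode (k, i) \<Longrightarrow>
      \<bar>f l j (entry l k (x k i))\<bar> \<le> t * (1/4) ^ prod_encode (k, i) * onorm (\<lambda>v. f l j (entry l k v))"
    by (rule play_outcome) (rule that)
  have lin_f: "bounded_linear (f k i)" for k i
  proof -
    obtain I a where "f k i = (\<lambda>v. \<Sum>j\<in>I. a j * cf j v)" using f_comb by blast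
    then show ?thesis
      by (simp add: bounded_linear_sum bounded_linear_const_mult bounded_linear_cf)
  qed
  have "\<exists>B. bounded_linear B \<and> (\<forall>z. norm (B z) \<le> c * norm z) \<and> (\<forall>z. (\<lambda>j. cf j z *\<^sub>R x k j) sums B z)" for k
    by (rule block_synthesis[of "x k" c, OF x_dom[of _ k, folded c_def]]) auto
  then obtain Bk where Bk: "\<And>k. bounded_linear (Bk k)" "\<And>k z. norm (Bk k z) \<le> c * norm z"
    "\<And>k z. (\<lambda>j. cf j z *\<^sub>R x k j) sums Bk k z" by metis
  have f_summ: "summable (\<lambda>i. \<bar>f k i (e j)\<bar>)" for k j
  proof (rule summable_comparison_test'[of "\<lambda>i. t * (1/4) ^ i" j])
    show "norm \<bar>f k i (e j)\<bar> \<le> t * (1/4) ^ i" if "j \<le> i" for i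
      using order_trans[OF f_e[OF that, of k] mult_left_mono[OF quarter_power_le[of k i], of t]] t
      by simp
  qed (simp add: summable_geometric summable_mult)
  have "\<exists>A. bounded_linear A \<and> (\<forall>z. norm (A z) \<le> c * M * norm z) \<and> (\<forall>z. (\<lambda>i. f k i z *\<^sub>R e i) sums A z)" for k
    by (rule block_analysis[of "f k" c M, OF lin_f f_dom[of _ k, folded c_def] M c0 f_summ]) auto
  then obtain Ak where Ak: "\<And>k. bounded_linear (Ak k)" "\<And>k z. norm (Ak k z) \<le> c * M * norm z"
    "\<And>k z. (\<lambda>i. f k i z *\<^sub>R e i) sums Ak k z" by metis
  obtain B :: "'a linf \<Rightarrow>\<^sub>L 'a linf" where B: "\<And>z k. apply_bcontfun (B z) k = Bk k (apply_bcontfun z k)"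
    by (rule componentwise_operator[OF Bk(1,2) c0]) (rule that)
  obtain A :: "'a linf \<Rightarrow>\<^sub>L 'a linf" where A: "\<And>z k. apply_bcontfun (A z) k = Ak k (apply_bcontfun z k)"
    by (rule componentwise_operator[OF Ak(1,2) mult_nonneg_nonneg[OF c0 M0]]) (rule that)
  have norm_entry: "norm (entry k l v) \<le> norm T * norm v" for k l v
    unfolding entry_def using order_trans[OF norm_bounded norm_blinfun[of T "single l v"]] by simp
  have norm_x: "norm (x l j) \<le> c" for l j
    using x_dom[OF finite_support_on[of "{j}" "\<lambda>_. 1"], of l]
      comb_norm_on[of "{j}" "x l" "\<lambda>_. 1"] comb_norm_on[of "{j}" e "\<lambda>_. 1"]
    by (simp add: c_def)
  have cf_onorm: "onorm (cf j) \<le> 2 * M" for j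
    by (rule onorm_bound) (use M0 abs_cf_le[OF M] in \<open>auto simp: mult_ac\<close>)
  have f_onorm: "onorm (f l j) \<le> c * (2 * M)" for l j
  proof -
    have "onorm (f l j) \<le> c * onorm (cf j)"
      using f_dom[OF finite_support_on[of "{j}" "\<lambda>_. 1"], of l]
        dual_comb_norm_on[of "{j}" "f l" "\<lambda>_. 1"] dual_comb_norm_on[of "{j}" cf "\<lambda>_. 1"]
      by (simp add: c_def)
    also have "\<dots> \<le> c * (2 * M)" by (rule mult_left_mono[OF cf_onorm c0])
    finally show ?thesis .
  qed
  have norm_entry_x: "norm (entry k l (x l j)) \<le> \<beta>" for k l j
  proof -
    have "norm (entry k l (x l j)) \<le> norm T * c"
      by (rule order_trans[OF norm_entry mult_left_mono[OF norm_x]]) simp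
    also have "\<dots> * 1 \<le> norm T * c * (2 * M)" using M1 c0 by (intro mult_left_mono) auto
    finally show ?thesis by (simp add: \<beta>_def mult_ac)
  qed
  have onorm_f_entry: "onorm (\<lambda>v. f l j (entry l k v)) \<le> \<beta>" for l j k
  proof (rule onorm_bound[OF \<beta>])
    fix v
    have "norm (f l j (entry l k v)) \<le> onorm (f l j) * norm (entry l k v)"
      by (rule onorm[OF lin_f])
    also have "\<dots> \<le> (c * (2 * M)) * (norm T * norm v)"
      using f_onorm norm_entry c0 M0 by (intro mult_mono) auto
    finally show "norm (f l j (entry l k v)) \<le> \<beta> * norm v" by (simp add: \<beta>_def mult_ac)
  qed
  have off: "\<bar>f k i (entry k l (x l j))\<bar> \<le> (t * \<beta> * (1/2) ^ i) * ((1/2) ^ l * (1/2) ^ j)"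
    if ne: "(l, j) \<noteq> (k, i)" for k i l j
  proof -
    have "prod_encode (l, j) \<noteq> prod_encode (k, i)" using ne by simp
    then consider "prod_encode (l, j) < prod_encode (k, i)" | "prod_encode (k, i) < prod_encode (l, j)"
      by linarith
    then obtain n where n: "\<bar>f k i (entry k l (x l j))\<bar> \<le> t * (1/4) ^ n * \<beta>"
      "(1/4) ^ n \<le> (1/2) ^ i * ((1/2) ^ l * (1/2::real) ^ j)"
    proof cases
      case 1
      show ?thesis
      proof (rule that)
        show "\<bar>f k i (entry k l (x l j))\<bar> \<le> t * (1/4) ^ prod_encode (k, i) * \<beta>"
          using order_trans[OF below[OF 1]
              mult_left_mono[OF norm_entry_x, of "t * (1/4) ^ prod_encode (k, i)"]] t
          by simp
      qed (use off_diagonal_weight[of k i _ l j] 1 in simp)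
    next
      case 2
      show ?thesis
      proof (rule that)
        show "\<bar>f k i (entry k l (x l j))\<bar> \<le> t * (1/4) ^ prod_encode (l, j) * \<beta>"
          using order_trans[OF above[OF 2]
              mult_left_mono[OF onorm_f_entry, of "t * (1/4) ^ prod_encode (l, j)"]] t
          by simp
      qed (use off_diagonal_weight[of k i _ l j] 2 in simp)
    qed
    have "t * (1/4) ^ n * \<beta> = (t * \<beta>) * (1/4) ^ n" by simp
    also have "\<dots> \<le> (t * \<beta>) * ((1/2) ^ i * ((1/2) ^ l * (1/2::real) ^ j))"
      using n(2) t \<beta> by (intro mult_left_mono) auto
    finally show ?thesis using n(1) by (simp add: mult_ac)
  qed
  \<comment> \<open>\<open>\<rho> k i z\<close> is the \<open>(k, i)\<close> coordinate of \<open>A T B z - D z\<close>\<close>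
  define dd where "dd k i = f k i (entry k k (x k i))" for k i
  define \<rho> where "\<rho> k i z = f k i (apply_bcontfun (T (B z)) k) - dd k i * cf i (apply_bcontfun z k)"
    for k i z
  have \<rho>_le: "\<bar>\<rho> k i z\<bar> \<le> 8 * M * (t * \<beta>) * norm z * (1/2) ^ i" for k i z
  proof -
    let ?\<phi> = "\<lambda>z. f k i (apply_bcontfun (T z) k)"
    have lin: "bounded_linear ?\<phi>"
      by (rule bounded_linear_compose[OF lin_f]
          bounded_linear_compose[OF bounded_linear_apply] blinfun.bounded_linear_right)+
    obtain I a where fI: "f k i = (\<lambda>v. \<Sum>j\<in>I. a j * cf j v)" using f_comb by blast
    have "tail_null ?\<phi>" unfolding fI by (rule tail_null_combination) (rule null)
    then have "\<bar>?\<phi> (B z) - ?\<phi> (single k (x k i)) * cf i (apply_bcontfun z k)\<bar>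
        \<le> 8 * M * (t * \<beta> * (1/2) ^ i) * norm z"
      by (rule off_diagonal_estimate[OF lin _ _ M])
        (use off t \<beta> in \<open>auto simp: B Bk(3) entry_def\<close>)
    then show ?thesis by (simp add: \<rho>_def dd_def entry_def mult_ac)
  qed
  have geo: "(\<lambda>j. b * (1/2::real) ^ j) sums (b * 2)" for b
    using geometric_sums[of "1/2::real"] by (intro sums_mult) simp
  have \<rho>_abs: "summable (\<lambda>i. norm (\<rho> k i z *\<^sub>R e i))" for k z
    by (rule summable_comparison_test'[OF sums_summable[OF geo], of 0]) (use \<rho>_le in simp)
  have \<rho>_summ: "summable (\<lambda>i. \<rho> k i z *\<^sub>R e i)" for k z
    by (rule summable_norm_cancel[OF \<rho>_abs])
  have \<rho>_add: "\<rho> k i (y + z) = \<rho> k i y + \<rho> k i z" for k i y z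
    using bounded_linear.linear[OF lin_f[of k i]]
    by (simp add: \<rho>_def blinfun.add_right linear_add cf_add algebra_simps)
  have \<rho>_scale: "\<rho> k i (r *\<^sub>R z) = r * \<rho> k i z" for k i r z
    using bounded_linear.linear[OF lin_f[of k i]]
    by (simp add: \<rho>_def blinfun.scaleR_right linear_scale cf_scaleR algebra_simps)
  define F where "F z k = (\<Sum>i. \<rho> k i z *\<^sub>R e i)" for z k
  have F_add: "F (y + z) k = F y k + F z k" for y z k
    by (simp add: F_def \<rho>_add scaleR_left_distrib suminf_add[OF \<rho>_summ \<rho>_summ])
  have F_scale: "F (r *\<^sub>R z) k = r *\<^sub>R F z k" for r z k
    using suminf_scaleR_right[OF \<rho>_summ[of k z], of r] by (simp add: F_def \<rho>_scale)
  have F_norm: "norm (F z k) \<le> 16 * M * (t * \<beta>) * norm z" for z k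
  proof -
    have "norm (F z k) \<le> (\<Sum>i. norm (\<rho> k i z *\<^sub>R e i))" unfolding F_def by (rule summable_norm[OF \<rho>_abs])
    also have "\<dots> \<le> (\<Sum>i. 8 * M * (t * \<beta>) * norm z * (1/2) ^ i)"
      by (rule suminf_le[OF _ \<rho>_abs sums_summable[OF geo]]) (use \<rho>_le in simp)
    also have "\<dots> = 8 * M * (t * \<beta>) * norm z * 2" by (rule sums_unique[OF geo, symmetric])
    finally show ?thesis by simp
  qed
  have nonneg: "0 \<le> 16 * M * (t * \<beta>)" using M0 t \<beta> by simp
  obtain R :: "'a linf \<Rightarrow>\<^sub>L 'a linf" where R: "\<And>z k. apply_bcontfun (R z) k = F z k"
    and norm_R: "norm R \<le> 16 * M * (t * \<beta>)"
    by (rule linf_operator[OF F_add F_scale F_norm nonneg]) (rule that)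
  define D where "D = (A o\<^sub>L T o\<^sub>L B) - R"
  have D_sums: "(\<lambda>i. (dd k i * cf i (apply_bcontfun z k)) *\<^sub>R e i) sums apply_bcontfun (D z) k" for z k
  proof -
    have "(\<lambda>i. f k i (apply_bcontfun (T (B z)) k) *\<^sub>R e i - \<rho> k i z *\<^sub>R e i)
        sums (Ak k (apply_bcontfun (T (B z)) k) - F z k)"
      unfolding F_def by (intro sums_diff Ak(3) summable_sums \<rho>_summ)
    then show ?thesis
      by (simp add: D_def blinfun.diff_left A R \<rho>_def scaleR_left_diff_distrib)
  qed
  define Dk where "Dk k = Blinfun (\<lambda>v. apply_bcontfun (D (single k v)) k)" for k
  have Dk: "blinfun_apply (Dk k) v = apply_bcontfun (D (single k v)) k" for k v
    unfolding Dk_def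
    by (rule fun_cong[OF bounded_linear_Blinfun_apply])
      (rule bounded_linear_compose[OF bounded_linear_apply]
          bounded_linear_compose[OF blinfun.bounded_linear_right] bounded_linear_single)+
  have Dk_sums: "(\<lambda>i. (dd k i * cf i v) *\<^sub>R e i) sums Dk k v" for k v
    using D_sums[of k "single k v"] by (simp add: Dk)
  have D_Dk: "apply_bcontfun (D z) k = Dk k (apply_bcontfun z k)" for z k
    by (rule sums_unique2[OF D_sums Dk_sums])
  have Dk_coord: "cf m (Dk k (e j)) = (if m = j then dd k j else 0)" for m k j
    using cf_unique[OF Dk_sums[of k "e j"]] by (simp add: cf_basis)
  have "identity_almost_factors (K (\<delta> / 2)) (Dk k)" for k
  proof -
    have "diagonal_operator e (Dk k)" by (simp add: diagonal_operator_def Dk_coord)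
    moreover have "\<delta> / 2 \<le> (INF j. \<bar>cf j (Dk k (e j))\<bar>)"
      by (rule cINF_greatest) (use diag in \<open>simp_all add: Dk_coord dd_def\<close>)
    ultimately show ?thesis
      using dfp \<delta> unfolding diagonal_factorization_property_def by simp
  qed
  then have factors: "identity_factors \<kappa> (Dk k)" for k
    by (simp add: identity_almost_factors_def \<kappa>_def)
  have "\<exists>A B :: 'a \<Rightarrow>\<^sub>L 'a. norm A \<le> 1 \<and> norm B \<le> \<kappa> \<and> (\<forall>v. blinfun_apply A (Dk k (blinfun_apply B v)) = v)" for k
    by (rule identity_factors_normalized[OF factors[of k]]) blast
  then obtain A' B' :: "nat \<Rightarrow> 'a \<Rightarrow>\<^sub>L 'a" where A': "\<And>k. norm (A' k) \<le> 1" and B': "\<And>k. norm (B' k) \<le> \<kappa>"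
    and A'B': "\<And>k v. blinfun_apply (A' k) (Dk k (blinfun_apply (B' k) v)) = v"
    by metis
  have A'_norm: "norm (A' k v) \<le> 1 * norm v" and B'_norm: "norm (B' k v) \<le> \<kappa> * norm v" for k v
    using norm_blinfun[of "A' k" v] mult_right_mono[OF A'[of k] norm_ge_zero[of v]]
      norm_blinfun[of "B' k" v] mult_right_mono[OF B'[of k] norm_ge_zero[of v]] by linarith+
  obtain A1 :: "'a linf \<Rightarrow>\<^sub>L 'a linf" where
    A1: "\<And>z k. apply_bcontfun (A1 z) k = A' k (apply_bcontfun z k)" "norm A1 \<le> 1"
    by (rule componentwise_operator[OF blinfun.bounded_linear_right A'_norm zero_le_one]) (rule that)
  obtain B1 :: "'a linf \<Rightarrow>\<^sub>L 'a linf" where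
    B1: "\<And>z k. apply_bcontfun (B1 z) k = B' k (apply_bcontfun z k)" "norm B1 \<le> \<kappa>"
    by (rule componentwise_operator[OF blinfun.bounded_linear_right B'_norm less_imp_le[OF \<kappa>]]) (rule that)
  have factor_D: "A1 (D (B1 z)) = z" for z
    by (rule bcontfun_eqI) (simp add: A1 B1 D_Dk A'B')
  have eq: "A1 o\<^sub>L (A o\<^sub>L T o\<^sub>L B) o\<^sub>L B1 = id_blinfun + (A1 o\<^sub>L R o\<^sub>L B1)"
  proof (rule blinfun_eqI)
    fix z
    have "(A o\<^sub>L T o\<^sub>L B) y = D y + R y" for y by (simp add: D_def blinfun.diff_left)
    then show "blinfun_apply (A1 o\<^sub>L (A o\<^sub>L T o\<^sub>L B) o\<^sub>L B1) z
        = blinfun_apply (id_blinfun + (A1 o\<^sub>L R o\<^sub>L B1)) z"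
      by (simp add: blinfun.add_right blinfun.add_left factor_D)
  qed
  have "norm (A1 o\<^sub>L R o\<^sub>L B1) \<le> norm (A1 o\<^sub>L R) * norm B1" by (rule norm_blinfun_compose)
  also have "\<dots> \<le> (1 * (16 * M * (t * \<beta>))) * \<kappa>"
    using order_trans[OF norm_blinfun_compose[of A1 R] mult_mono[OF A1(2) norm_R]] B1(2) nonneg
    by (intro mult_mono) auto
  also have "\<dots> < 1" using t_small by (simp add: mult.commute)
  finally have "norm (A1 o\<^sub>L R o\<^sub>L B1) < 1" .
  then obtain S where "S o\<^sub>L (id_blinfun + (A1 o\<^sub>L R o\<^sub>L B1)) = id_blinfun"
    by (rule left_inverse_near_identity)
  then have "S o\<^sub>L (A1 o\<^sub>L (A o\<^sub>L T o\<^sub>L B) o\<^sub>L B1) = id_blinfun" by (simp only: eq)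
  from arg_cong[OF this, of "\<lambda>L. blinfun_apply L z" for z]
  have "id_blinfun = (S o\<^sub>L A1 o\<^sub>L A) o\<^sub>L T o\<^sub>L (B o\<^sub>L B1)"
    by (intro blinfun_eqI) simp
  then show ?thesis by (rule that)
qed

end

theorem corollary3p8:
  fixes e :: "nat \<Rightarrow> 'a::banach"
    and C :: real
    and K :: "real \<Rightarrow> real"
  assumes "normalized_schauder_basis UNIV e"
    and "C \<ge> 1"
    and "strategically_reproducible C UNIV e"
    and "\<And>\<delta>. \<delta> > 0 \<Longrightarrow> K \<delta> > 0"
    and "diagonal_factorization_property K e"
  shows "simultaneously_strategically_reproducible C (array e) \<and>
    (\<forall>T :: 'a linf \<Rightarrow>\<^sub>L 'a linf.
       (INF (k, j)\<in>UNIV. \<bar>array_coord e k j (blinfun_apply T (array e k j))\<bar>) > 0 \<longrightarrow>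
       (\<exists>A B :: 'a linf \<Rightarrow>\<^sub>L 'a linf. id_blinfun = A o\<^sub>L T o\<^sub>L B))"
proof (intro conjI allI impI)
  show "simultaneously_strategically_reproducible C (array e)"
    using strategically_reproducible_component[OF assms(3)]
    by (simp add: simultaneously_strategically_reproducible_def)
next
  fix T :: "'a linf \<Rightarrow>\<^sub>L 'a linf"
  interpret schauder e by unfold_locales (rule assms(1))
  define \<delta> where "\<delta> = (INF (k, j)\<in>UNIV. \<bar>array_coord e k j (T (array e k j))\<bar>)"
  assume "0 < (INF (k, j)\<in>UNIV. \<bar>array_coord e k j (T (array e k j))\<bar>)"
  then have \<delta>: "0 < \<delta>" by (simp add: \<delta>_def)
  have large: "\<delta> \<le> \<bar>array_coord e k j (T (array e k j))\<bar>" for k j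
  proof -
    have "bdd_below (range (\<lambda>(k, j). \<bar>array_coord e k j (T (array e k j))\<bar>))"
      by (rule bdd_belowI2[of _ 0]) auto
    from cINF_lower[OF this, of "(k, j)"] show ?thesis by (simp add: \<delta>_def)
  qed
  obtain a :: "nat \<Rightarrow> nat" and J Q :: "'a linf \<Rightarrow>\<^sub>L 'a linf" where
    J: "\<And>k x. J (single k x) = single (a k) x"
    and Q: "\<And>z k. apply_bcontfun (Q z) k = apply_bcontfun z (a k)"
    and null: "\<And>k j. tail_null (\<lambda>z. cf j (apply_bcontfun ((Q o\<^sub>L T o\<^sub>L J) z) k))"
    by (rule compression_to_tail_null[of cf T, OF bounded_linear_cf]) (rule that)
  have large': "\<delta> \<le> \<bar>array_coord e k j ((Q o\<^sub>L T o\<^sub>L J) (array e k j))\<bar>" for k j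
    using large[of "a k" j] by (simp add: array_coord_def array_def J Q)
  \<comment> \<open>any \<open>\<eta> < 1\<close> would do: it keeps \<open>\<Sum>\<lambda>\<^sub>i \<mu>\<^sub>i\<close>, and with it the new diagonal entries, away from \<open>0\<close>\<close>
  obtain \<sigma> where "winning_strategy UNIV e C (1/2) \<sigma>"
    using assms(3) unfolding strategically_reproducible_def by (meson half_gt_zero zero_less_one)
  then obtain A B :: "'a linf \<Rightarrow>\<^sub>L 'a linf" where "id_blinfun = A o\<^sub>L (Q o\<^sub>L T o\<^sub>L J) o\<^sub>L B"
    using assms(2)
    by (rule_tac factorization_of_tail_null_operator[OF _ _ assms(4,5) \<delta> large' null]) auto
  from arg_cong[OF this, of "\<lambda>L. blinfun_apply L z" for z]
  have "id_blinfun = (A o\<^sub>L Q) o\<^sub>L T o\<^sub>L (J o\<^sub>L B)"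
    by (intro blinfun_eqI) simp
  then show "\<exists>A B :: 'a linf \<Rightarrow>\<^sub>L 'a linf. id_blinfun = A o\<^sub>L T o\<^sub>L B" by blast
qed

end
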